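(* Let $X$ and $Y$ be pathwise connected compact metric spaces, and let $E$ be a smooth reflexive Banach space which is $2$-iso-reflexive. Suppose that $\Delta$ is a $2$-local isometry from $\mathrm{Lip}(X,E)$ to $\mathrm{Lip}(Y,E)$. Then there exist a Lipschitz homeomorphism $\psi$ from $Y$ onto $X$ and a continuous map $V$ from $Y$ into $(\mathrm{Iso}(E),\mathrm{SOT})$ such that $$\Delta(f)(y)=V(y)(f(\psi(y))),\quad\forall y\in Y,\ f\in\mathrm{Lip}(X,E).$$ Moreover, $\Delta$ is a surjective linear isometry.
   Context: Banach spaces are over the scalar field $\mathbb{K}=\mathbb{R}$ or $\mathbb{C}$ (the same field throughout). For a metric space $X$ and a normed space $E$, $\mathrm{Lip}(X,E)$ is the space of all bounded Lipschitz functions $f\colon X\to E$ with norm $\|f\|_L=\max\{L(f),\|f\|_\infty\}$, where $L(f)$ is the Lipschitz constant of $f$ and $\|f\|_\infty$ is its uniform norm. For Banach spaces $A,B$, $\mathrm{Iso}(A,B)$ is the set of all surjective linear isometries from $A$ onto $B$, and $\mathrm{Iso}(A)=\mathrm{Iso}(A,A)$. $\mathrm{SOT}$ denotes the strong operator topology. A (not necessarily linear or continuous) map $\Delta\colon A\to B$ between Banach spaces is a $2$-local isometry if for all $a,b\in A$ there exists $T_{a,b}\in\mathrm{Iso}(A,B)$, depending on $a$ and $b$, such that $\Delta(a)=T_{a,b}(a)$ and $\Delta(b)=T_{a,b}(b)$. A Banach space $A$ is $2$-iso-reflexive if every $2$-local isometry $A\to A$ is both linear and surjective. A normed space $E$ is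 smooth if for each $e\in E$ with $\|e\|=1$ there is a unique $e^*\in E^*$ with $\|e^*\|=1$ and $e^*(e)=1$. A Lipschitz homeomorphism is a bijection $\varphi$ such that both $\varphi$ and $\varphi^{-1}$ are Lipschitz. *)

theory Defs
  imports "HOL-Analysis.Analysis"
begin

section \<open>The scalar field: real or complex numbers\<close>

class real_or_complex = real_normed_field +
  assumes isometric_to_real_or_complex:
    "(\<exists>h :: 'a \<Rightarrow> real. bij h \<and>
         (\<forall>x y. h (x + y) = h x + h y) \<and> (\<forall>r x. h (r *\<^sub>R x) = r *\<^sub>R h x) \<and>
         (\<forall>x y. h (x * y) = h x * h y) \<and> (\<forall>x. norm (h x) = norm x))
   \<or> (\<exists>h :: 'a \<Rightarrow> complex. bij h \<and>
         (\<forall>x y. h (x + y) = h x + h y) \<and> (\<forall>r x. h (r *\<^sub>R x) = r *\<^sub>R h x) \<and>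
         (\<forall>x y. h (x * y) = h x * h y) \<and> (\<forall>x. norm (h x) = norm x))"

instance real :: real_or_complex
  by standard (rule disjI1, rule exI[of _ id], auto simp: scaleR_add_right)

instance complex :: real_or_complex
  by standard (rule disjI2, rule exI[of _ id], auto simp: scaleR_add_right)


section \<open>Normed spaces over the scalar field\<close>

text \<open>
  The type class \<open>real_normed_vector\<close> only carries real scalars. A normed space over
  \<open>'k :: real_or_complex\<close> is a type of that class with an explicit scalar multiplication
  \<open>s\<close> that is compatible with the norm and extends the given real one; it is a Banach space
  if the type belongs to the class \<open>banach\<close>.
\<close>

locale normed_space_over = vector_space s
  for s :: "'k::real_or_complex \<Rightarrow> 'e::real_normed_vector \<Rightarrow> 'e" +
  assumes norm_scale: "norm (s c x) = norm c * norm x"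
    and scale_of_real: "s (of_real r) x = r *\<^sub>R x"

definition Iso ::
  "('k::real_or_complex \<Rightarrow> 'a::real_normed_vector \<Rightarrow> 'a) \<Rightarrow>
   ('k \<Rightarrow> 'b::real_normed_vector \<Rightarrow> 'b) \<Rightarrow> ('a \<Rightarrow> 'b) set"
  where "Iso s1 s2 = {T. Vector_Spaces.linear s1 s2 T \<and> (\<forall>x. norm (T x) = norm x) \<and> surj T}"

definition two_local_isometry ::
  "('k::real_or_complex \<Rightarrow> 'a::real_normed_vector \<Rightarrow> 'a) \<Rightarrow>
   ('k \<Rightarrow> 'b::real_normed_vector \<Rightarrow> 'b) \<Rightarrow> ('a \<Rightarrow> 'b) \<Rightarrow> bool"
  where "two_local_isometry s1 s2 \<Delta> \<longleftrightarrow> (\<forall>a b. \<exists>T \<in> Iso s1 s2. \<Delta> a = T a \<and> \<Delta> b = T b)"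

definition two_iso_reflexive ::
  "('k::real_or_complex \<Rightarrow> 'a::real_normed_vector \<Rightarrow> 'a) \<Rightarrow> bool"
  where "two_iso_reflexive s \<longleftrightarrow>
    (\<forall>\<Delta>. two_local_isometry s s \<Delta> \<longrightarrow> Vector_Spaces.linear s s \<Delta> \<and> surj \<Delta>)"

text \<open>
  The dual space consists of the \<open>'k\<close>-linear elements of the type of bounded real-linear maps,
  from which it inherits the operator norm.
\<close>

definition dual ::
  "('k::real_or_complex \<Rightarrow> 'a::real_normed_vector \<Rightarrow> 'a) \<Rightarrow> ('a \<Rightarrow>\<^sub>L 'k) set"
  where "dual s = {f. Vector_Spaces.linear s (*) (blinfun_apply f)}"

definition smooth ::
  "('k::real_or_complex \<Rightarrow> 'a::real_normed_vector \<Rightarrow> 'a) \<Rightarrow> bool"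
  where "smooth s \<longleftrightarrow>
    (\<forall>e. norm e = 1 \<longrightarrow> (\<exists>!f. f \<in> dual s \<and> norm f = 1 \<and> blinfun_apply f e = 1))"

text \<open>
  As the dual is a subset of a type, an element of the bidual is represented by a function whose
  linearity and boundedness are required, and whose values matter, on \<open>dual s\<close> only. The
  composition \<open>blinfun_mult_right c o\<^sub>L f\<close> is the scalar multiple of \<open>f\<close> by \<open>c\<close>.
\<close>

definition bidual_functional ::
  "('k::real_or_complex \<Rightarrow> 'a::real_normed_vector \<Rightarrow> 'a) \<Rightarrow> (('a \<Rightarrow>\<^sub>L 'k) \<Rightarrow> 'k) \<Rightarrow> bool"
  where "bidual_functional s \<Phi> \<longleftrightarrow>
    (\<forall>f \<in> dual s. \<forall>g \<in> dual s. \<Phi> (f + g) = \<Phi> f + \<Phi> g) \<and>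
    (\<forall>c. \<forall>f \<in> dual s. \<Phi> (blinfun_mult_right c o\<^sub>L f) = c * \<Phi> f) \<and>
    (\<exists>C. \<forall>f \<in> dual s. norm (\<Phi> f) \<le> C * norm f)"

definition reflexive_space ::
  "('k::real_or_complex \<Rightarrow> 'a::real_normed_vector \<Rightarrow> 'a) \<Rightarrow> bool"
  where "reflexive_space s \<longleftrightarrow>
    (\<forall>\<Phi>. bidual_functional s \<Phi> \<longrightarrow> (\<exists>x. \<forall>f \<in> dual s. \<Phi> f = blinfun_apply f x))"


section \<open>Spaces of bounded Lipschitz functions\<close>

typedef (overloaded) ('x::metric_space, 'e::real_normed_vector) lip =
  "{f :: 'x \<Rightarrow> 'e. bounded (range f) \<and> (\<exists>C. C-lipschitz_on UNIV f)}"
  morphisms apply_lip Abs_lip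
  by (rule exI[of _ "\<lambda>_. 0"]) (auto intro: lipschitz_on_constant)

setup_lifting type_definition_lip

lemma lip_eqI: "(\<And>x. apply_lip f x = apply_lip g x) \<Longrightarrow> f = g"
  by transfer auto

text \<open>Pairs with \<open>x = y\<close> contribute the value \<open>0\<close>, since \<open>a / 0 = 0\<close>.\<close>

definition lip_const :: "('x::metric_space \<Rightarrow> 'e::real_normed_vector) \<Rightarrow> real"
  where "lip_const f = (SUP (x, y). dist (f x) (f y) / dist x y)"

definition sup_norm :: "('x \<Rightarrow> 'e::real_normed_vector) \<Rightarrow> real"
  where "sup_norm f = (SUP x. norm (f x))"

lemma lip_const_le_iff:
  fixes f :: "'x::metric_space \<Rightarrow> 'e::real_normed_vector"
  assumes "\<exists>D. D-lipschitz_on UNIV f"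
  shows "lip_const f \<le> C \<longleftrightarrow> C-lipschitz_on UNIV f"
proof -
  obtain D where D: "D-lipschitz_on UNIV f" using assms by blast
  let ?q = "\<lambda>(x, y). dist (f x) (f y) / dist x y"
  have q_le: "?q p \<le> K" if "K-lipschitz_on UNIV f" for K p
    using that by (cases p) (auto simp: lipschitz_on_def divide_simps)
  have bdd: "bdd_above (range ?q)"
    using q_le[OF D] by (intro bdd_aboveI) auto
  have "lip_const f \<le> C \<longleftrightarrow> (\<forall>p. ?q p \<le> C)"
    unfolding lip_const_def using cSUP_le_iff[OF _ bdd] by auto
  also have "\<dots> \<longleftrightarrow> C-lipschitz_on UNIV f"
  proof
    assume *: "\<forall>p. ?q p \<le> C"
    have "?q (undefined, undefined) \<le> C" using * by blast
    then have "0 \<le> C" by simp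
    moreover have "dist (f x) (f y) \<le> C * dist x y" for x y
      using *[rule_format, of "(x, y)"] by (cases "x = y") (auto simp: divide_simps)
    ultimately show "C-lipschitz_on UNIV f" by (auto simp: lipschitz_on_def)
  qed (use q_le in blast)
  finally show ?thesis .
qed

lemma sup_norm_le_iff:
  assumes "bounded (range f)"
  shows "sup_norm f \<le> C \<longleftrightarrow> (\<forall>x. norm (f x) \<le> C)"
proof -
  have "bdd_above (range (\<lambda>x. norm (f x)))"
    using assms by (auto simp: bounded_iff bdd_above_def)
  then show ?thesis unfolding sup_norm_def by (subst cSUP_le_iff) auto
qed

instantiation lip :: (metric_space, real_normed_vector) real_vector
begin

lift_definition uminus_lip :: "('a, 'b) lip \<Rightarrow> ('a, 'b) lip" is "\<lambda>f x. - f x"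
  by (auto intro: lipschitz_on_minus simp: bounded_iff)

lift_definition plus_lip :: "('a, 'b) lip \<Rightarrow> ('a, 'b) lip \<Rightarrow> ('a, 'b) lip" is "\<lambda>f g x. f x + g x"
  by (auto intro: lipschitz_on_add bounded_plus_comp)

lift_definition minus_lip :: "('a, 'b) lip \<Rightarrow> ('a, 'b) lip \<Rightarrow> ('a, 'b) lip" is "\<lambda>f g x. f x - g x"
  by (auto intro: lipschitz_on_diff bounded_minus_comp)

lift_definition zero_lip :: "('a, 'b) lip" is "\<lambda>_. 0"
  by (auto intro: lipschitz_on_constant)

lift_definition scaleR_lip :: "real \<Rightarrow> ('a, 'b) lip \<Rightarrow> ('a, 'b) lip" is "\<lambda>r f x. r *\<^sub>R f x"
  by (auto intro: lipschitz_on_cmult bounded_scaleR_comp)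

lemmas [simp] = uminus_lip.rep_eq plus_lip.rep_eq minus_lip.rep_eq zero_lip.rep_eq scaleR_lip.rep_eq

instance
  by standard (auto intro!: lip_eqI simp: algebra_simps)

end

instantiation lip :: (metric_space, real_normed_vector) real_normed_vector
begin

definition norm_lip :: "('a, 'b) lip \<Rightarrow> real"
  where "norm_lip f = max (lip_const (apply_lip f)) (sup_norm (apply_lip f))"

definition sgn_lip :: "('a, 'b) lip \<Rightarrow> ('a, 'b) lip"
  where "sgn_lip f = f /\<^sub>R norm f"

definition dist_lip :: "('a, 'b) lip \<Rightarrow> ('a, 'b) lip \<Rightarrow> real"
  where "dist_lip f g = norm (f - g)"

definition uniformity_lip :: "(('a, 'b) lip \<times> ('a, 'b) lip) filter"
  where "uniformity_lip = (INF e\<in>{0 <..}. principal {(x, y). dist x y < e})"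

definition open_lip :: "('a, 'b) lip set \<Rightarrow> bool"
  where "open_lip S = (\<forall>x\<in>S. \<forall>\<^sub>F (x', y) in uniformity. x' = x \<longrightarrow> y \<in> S)"

lemma norm_lip_le_iff:
  "norm (f :: ('a, 'b) lip) \<le> C \<longleftrightarrow>
     C-lipschitz_on UNIV (apply_lip f) \<and> (\<forall>x. norm (apply_lip f x) \<le> C)"
  using apply_lip[of f] by (simp add: norm_lip_def lip_const_le_iff sup_norm_le_iff)

instance
proof
  fix f g :: "('a, 'b) lip" and a :: real
  have f: "(norm f)-lipschitz_on UNIV (apply_lip f)" "norm (apply_lip f x) \<le> norm f" for f :: "('a, 'b) lip" and x
    using norm_lip_le_iff[of f "norm f"] by auto
  have nonneg: "0 \<le> norm f" for f :: "('a, 'b) lip"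
    using f(1) by (rule lipschitz_on_nonneg)
  show "norm (f + g) \<le> norm f + norm g"
    using f[of f] f[of g] by (auto simp: norm_lip_le_iff intro!: lipschitz_on_add norm_triangle_mono)
  have zero: "norm (0 :: ('a, 'b) lip) \<le> 0"
    by (auto simp: norm_lip_le_iff intro: lipschitz_on_constant)
  show "norm f = 0 \<longleftrightarrow> f = 0"
  proof
    assume "norm f = 0"
    then show "f = 0" using f(2)[of f] by (auto intro!: lip_eqI)
  next
    assume "f = 0"
    then show "norm f = 0" using zero nonneg[of f] by simp
  qed
  have le: "norm (a *\<^sub>R f) \<le> \<bar>a\<bar> * norm f" for a and f :: "('a, 'b) lip"
    using f[of f] by (auto simp: norm_lip_le_iff intro!: lipschitz_on_cmult mult_left_mono)
  show "norm (a *\<^sub>R f) = \<bar>a\<bar> * norm f"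
  proof (cases "a = 0")
    case True
    have "(0::real) *\<^sub>R f = 0" by (rule scaleR_zero_left)
    then show ?thesis using True zero nonneg[of "0 :: ('a, 'b) lip"] by simp
  next
    case False
    have "inverse a *\<^sub>R (a *\<^sub>R f) = f" using False by (simp only: scaleR_scaleR) (auto intro: lip_eqI)
    then have "norm f \<le> \<bar>inverse a\<bar> * norm (a *\<^sub>R f)" using le[of "inverse a" "a *\<^sub>R f"] by simp
    then have "\<bar>a\<bar> * norm f \<le> norm (a *\<^sub>R f)" using False by (simp add: field_simps)
    then show ?thesis using le[of a f] by linarith
  qed
qed (simp_all only: sgn_lip_def dist_lip_def uniformity_lip_def open_lip_def)

end

text \<open>
  The pointwise scalar multiplication; the argument of \<^const>\<open>Abs_lip\<close> is a bounded Lipschitz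
  function whenever \<open>s\<close> satisfies \<^locale>\<open>normed_space_over\<close>, as the next lemma records.
\<close>

definition scale_lip ::
  "('k \<Rightarrow> 'e \<Rightarrow> 'e) \<Rightarrow> 'k \<Rightarrow> ('x::metric_space, 'e::real_normed_vector) lip \<Rightarrow> ('x, 'e) lip"
  where "scale_lip s c f = Abs_lip (\<lambda>x. s c (apply_lip f x))"

context normed_space_over
begin

lemma apply_scale_lip: "apply_lip (scale_lip s c f) x = s c (apply_lip f x)"
proof -
  obtain C where C: "C-lipschitz_on UNIV (apply_lip f)" and b: "bounded (range (apply_lip f))"
    using apply_lip[of f] by blast
  have "(norm c * C)-lipschitz_on UNIV (\<lambda>x. s c (apply_lip f x))"
    using C
    by (auto simp: lipschitz_on_def dist_norm norm_scale scale_right_diff_distrib[symmetric]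
        mult.assoc intro!: mult_left_mono)
  moreover have "bounded (range (\<lambda>x. s c (apply_lip f x)))"
  proof -
    obtain B where "\<And>x. norm (apply_lip f x) \<le> B" using b by (auto simp: bounded_iff)
    then have "\<And>x. norm (s c (apply_lip f x)) \<le> norm c * B"
      by (simp add: norm_scale mult_left_mono)
    then show ?thesis by (auto simp: bounded_iff)
  qed
  ultimately show ?thesis
    unfolding scale_lip_def by (subst Abs_lip_inverse) auto
qed

lemma normed_space_over_lip:
  "normed_space_over (scale_lip s :: 'k \<Rightarrow> ('x::metric_space, 'e) lip \<Rightarrow> ('x, 'e) lip)"
proof
  fix a b c :: 'k and f g :: "('x, 'e) lip" and r :: real
  show "scale_lip s a (f + g) = scale_lip s a f + scale_lip s a g"
    by (rule lip_eqI) (simp add: apply_scale_lip scale_right_distrib)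
  show "scale_lip s (a + b) f = scale_lip s a f + scale_lip s b f"
    by (rule lip_eqI) (simp add: apply_scale_lip scale_left_distrib)
  show "scale_lip s a (scale_lip s b f) = scale_lip s (a * b) f"
    by (rule lip_eqI) (simp add: apply_scale_lip)
  show "scale_lip s 1 f = f"
    by (rule lip_eqI) (simp add: apply_scale_lip)
  show "scale_lip s (of_real r) f = r *\<^sub>R f"
    by (rule lip_eqI) (simp add: apply_scale_lip scale_of_real)
  have "dist (s c u) (s c v) = dist (norm c *\<^sub>R u) (norm c *\<^sub>R v)" for u v :: 'e
    by (simp add: dist_norm scale_right_diff_distrib[symmetric] scaleR_right_diff_distrib[symmetric]
        norm_scale)
  then have "norm (scale_lip s c f) = norm (norm c *\<^sub>R f)"
    by (simp add: norm_lip_def lip_const_def sup_norm_def apply_scale_lip norm_scale)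
  then show "norm (scale_lip s c f) = norm c * norm f"
    by simp
qed

end


section \<open>Lipschitz homeomorphisms\<close>

definition lipschitz_homeomorphism :: "('y::metric_space \<Rightarrow> 'x::metric_space) \<Rightarrow> bool"
  where "lipschitz_homeomorphism \<psi> \<longleftrightarrow>
    bij \<psi> \<and> (\<exists>C. C-lipschitz_on UNIV \<psi>) \<and> (\<exists>C. C-lipschitz_on UNIV (inv \<psi>))"

end

theory Submission
  imports Defs
begin

text \<open>
  The point is the structure of a single surjective linear isometry \<open>T\<close> from \<open>Lip(X,E)\<close> onto
  \<open>Lip(Y,E)\<close>. Write \<open>\<phi>\<^sub>e\<close> for the unique functional of norm one with \<open>\<phi>\<^sub>e(e) = \<parallel>e\<parallel>\<close>, for \<open>e \<noteq> 0\<close>.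
  The functional \<open>g \<mapsto> \<phi>\<^sub>e(g(y))\<close> is the only one of norm at most one whose value is \<open>2\<parallel>e\<parallel>\<close>, the
  norm of the argument, at the peak \<open>z \<mapsto> (1 + max 0 (1 - d(z,y))) e\<close> (\<open>functional_attaining_peak\<close>). The preimage of the peak
  under \<open>T\<close> has the norm of the peak, which on the compact space \<open>X\<close> is either the norm of one of
  its values or a supremum of difference quotients. So the transported functional
  \<open>f \<mapsto> \<phi>\<^sub>e(T f (y))\<close> is either of the form \<open>f \<mapsto> q(f(x))\<close> or a limit of difference quotients, which
  vanishes on the constant functions (\<open>point_or_derivation_type\<close>).

  Both alternatives are closed conditions on \<open>(y, e)\<close> and they exclude each other. As \<open>Y\<close> is
  connected and \<open>e\<close> can be moved through nonzero vectors, only one of them occurs; the second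
  cannot occur throughout, because \<open>T\<close> does not annihilate the constants
  (\<open>point_type_everywhere\<close>). Next, the point \<open>x\<close> does not depend on \<open>e\<close>: otherwise the values at \<open>y\<close>
  of the images of two functions with disjoint supports would span a plane in \<open>E\<close> with a maximum
  norm, whose sphere has corners (\<open>support_not_disjoint\<close>). Hence \<open>T f (y) = V\<^sub>y(f(\<psi>(y)))\<close>, and
  applying this to \<open>T\<close> and its inverse shows that \<open>\<psi>\<close> is bijective and each \<open>V\<^sub>y\<close> an isometry of
  \<open>E\<close> onto itself (\<open>isometry_weighted_composition\<close>). Moreover \<open>\<psi>\<close> preserves the truncated metric
  \<open>min d 1\<close>, which gives Lipschitz bounds common to all \<open>T\<close>.

  Let now \<open>\<Delta>\<close> be a two-local isometry. The norm of the peak at \<open>x\<close> takes its maximum at \<open>x\<close> only, so its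
  image recognises the point \<open>\<sigma>(x)\<close> of \<open>Y\<close> that every isometry agreeing with \<open>\<Delta>\<close> at this peak
  couples with \<open>x\<close>. Comparing an arbitrary function with a peak having the same value at \<open>x\<close> shows
  that \<open>\<Delta> g (\<sigma>(x))\<close> is a function \<open>W\<^sub>x\<close> of \<open>g(x)\<close> alone (\<open>\<Delta>_at_\<sigma>\<close>). Each \<open>W\<^sub>x\<close> is a two-local isometry
  of \<open>E\<close>, so linear and surjective since \<open>E\<close> is 2-iso-reflexive. Finally \<open>\<sigma>\<close> is onto: followed by one of the maps
  \<open>\<psi>\<close> it preserves the truncated metric of the compact space \<open>X\<close>, and such a self-map is onto.
\<close>

section \<open>Contractive functionals and their cluster points\<close>

definition dual_ball ::
  "('k::real_or_complex \<Rightarrow> 'a::real_normed_vector \<Rightarrow> 'a) \<Rightarrow> ('a \<Rightarrow> 'k) set"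
  where "dual_ball s = {q. Vector_Spaces.linear s (*) q \<and> (\<forall>v. norm (q v) \<le> norm v)}"

text \<open>
  The scalar field is only known up to an isometry onto the real or the complex numbers, so
  the compactness of its closed balls has to be transported along that isometry.
\<close>

lemma compact_cball_of_isometry:
  fixes h :: "'a::real_normed_vector \<Rightarrow> 'b::{real_normed_vector,heine_borel}"
  assumes "bij h" and add: "\<And>x y. h (x + y) = h x + h y" and norm: "\<And>x. norm (h x) = norm x"
  shows "compact (cball (0::'a) r)"
proof -
  interpret h: additive h by standard (rule add)
  have dist: "dist (h x) (h y) = dist x y" for x y :: 'a
    by (simp add: dist_norm norm flip: h.diff)
  have h_inv: "h (inv h y) = y" for y :: 'b
    using \<open>bij h\<close> by (simp add: bij_is_surj surj_f_inv_f)
  have "dist (inv h x) (inv h y) = dist x y" for x y :: 'b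
    by (metis dist h_inv)
  then have "continuous_on (cball 0 r) (inv h)"
    by (intro continuous_onI) auto
  then have "compact (inv h ` cball 0 r)"
    by (rule compact_continuous_image) (rule compact_cball)
  moreover have "inv h ` cball 0 r = cball 0 r"
  proof (intro set_eqI iffI)
    fix x :: 'a assume "x \<in> cball 0 r"
    then have "h x \<in> cball 0 r" "inv h (h x) = x"
      using \<open>bij h\<close> by (auto simp: norm bij_is_inj)
    then show "x \<in> inv h ` cball 0 r" by (metis imageI)
  next
    fix x :: 'a assume "x \<in> inv h ` cball 0 r"
    then show "x \<in> cball 0 r" using h_inv norm by (auto, metis)
  qed
  ultimately show ?thesis by simp
qed

lemma compact_cball_scalar: "compact (cball (0::'k::real_or_complex) r)"
  using isometric_to_real_or_complex
proof (elim disjE exE conjE)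
  fix h :: "'k \<Rightarrow> real" assume "bij h" "\<forall>x y. h (x + y) = h x + h y" "\<forall>x. norm (h x) = norm x"
  then show ?thesis by (intro compact_cball_of_isometry[of h]) auto
next
  fix h :: "'k \<Rightarrow> complex" assume "bij h" "\<forall>x y. h (x + y) = h x + h y" "\<forall>x. norm (h x) = norm x"
  then show ?thesis by (intro compact_cball_of_isometry[of h]) auto
qed

lemma vector_space_mult: "vector_space ((*) :: 'k::field \<Rightarrow> 'k \<Rightarrow> 'k)"
  by standard (auto simp: algebra_simps)

context normed_space_over
begin

lemma linear_functional_iff:
  "Vector_Spaces.linear s (*) q \<longleftrightarrow>
     (\<forall>u v. q (u + v) = q u + q v) \<and> (\<forall>c v. q (s c v) = c * q v)"
  using vector_space_axioms vector_space_mult by (auto simp: Vector_Spaces.linear_iff)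

lemma dual_ball_iff:
  "q \<in> dual_ball s \<longleftrightarrow> (\<forall>u v. q (u + v) = q u + q v) \<and> (\<forall>c v. q (s c v) = c * q v) \<and>
     (\<forall>v. norm (q v) \<le> norm v)"
  by (simp add: dual_ball_def linear_functional_iff conj_assoc)

lemma
  assumes "q \<in> dual_ball s"
  shows dual_ball_add: "q (u + v) = q u + q v" and dual_ball_scale: "q (s c v) = c * q v"
    and dual_ball_le: "norm (q v) \<le> norm v" and dual_ball_diff: "q (u - v) = q u - q v"
    and dual_ball_scaleR: "q (r *\<^sub>R v) = of_real r * q v" and dual_ball_zero: "q 0 = 0"
    and dual_ball_minus: "q (- v) = - q v"
proof -
  show add: "q (u + v) = q u + q v" for u v using assms by (simp add: dual_ball_iff)
  interpret q: additive q by standard (rule add)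
  show scale: "q (s c v) = c * q v" for c v using assms by (simp add: dual_ball_iff)
  show "norm (q v) \<le> norm v" using assms by (simp add: dual_ball_iff)
  show "q (u - v) = q u - q v" "q 0 = 0" "q (- v) = - q v" by (rule q.diff q.zero q.minus)+
  show "q (r *\<^sub>R v) = of_real r * q v" using scale[of "of_real r" v] by (simp add: scale_of_real)
qed

text \<open>
  The sequential form of the Banach-Alaoglu theorem that survives without separability: there
  need not be a convergent subsequence, but a cluster point in the product topology exists by
  Tychonoff's theorem, and it takes the limit value wherever the sequence converges.
\<close>

lemma dual_ball_cluster:
  fixes q :: "nat \<Rightarrow> 'e \<Rightarrow> 'k"
  assumes q: "\<And>n. q n \<in> dual_ball s"
  obtains \<Lambda> where "\<Lambda> \<in> dual_ball s" and "\<And>v a. (\<lambda>n. q n v) \<longlonglongrightarrow> a \<Longrightarrow> \<Lambda> v = a"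
proof -
  let ?K = "PiE UNIV (\<lambda>v. cball 0 (norm v)) :: ('e \<Rightarrow> 'k) set"
  have "compactin (product_topology (\<lambda>_. euclidean) UNIV) ?K"
    by (simp add: compactin_PiE compact_cball_scalar)
  then have K: "compact ?K" by (simp add: euclidean_product_topology)
  have "eventually (\<lambda>x. x \<in> ?K) (filtermap q sequentially)"
    using dual_ball_le[OF q] by (simp add: eventually_filtermap PiE_def Pi_def)
  then obtain \<Lambda> where "\<Lambda> \<in> ?K" and ne: "inf (nhds \<Lambda>) (filtermap q sequentially) \<noteq> bot"
    using K[unfolded compact_filter, rule_format, of "filtermap q sequentially"]
    by (auto simp: filtermap_bot_iff)
  define G where "G = inf (nhds \<Lambda>) (filtermap q sequentially)"
  have lim: "((\<lambda>f. f v) \<longlongrightarrow> \<Lambda> v) G" for v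
  proof -
    have "((\<lambda>f. f v) \<longlongrightarrow> \<Lambda> v) (at \<Lambda>)"
      using continuous_on_product_coordinates[of v, where ?'b = 'k] by (simp add: continuous_on_def)
    then have "((\<lambda>f. f v) \<longlongrightarrow> \<Lambda> v) (nhds \<Lambda>)"
      by (simp only: tendsto_at_iff_tendsto_nhds[of "\<lambda>f. f v" \<Lambda>])
    then show ?thesis unfolding G_def by (rule tendsto_mono[rotated]) simp
  qed
  have ev: "eventually P G" if "\<And>n. P (q n)" for P
  proof -
    have "eventually P (filtermap q sequentially)" using that by (simp add: eventually_filtermap)
    then show ?thesis unfolding G_def by (rule filter_leD[OF inf_le2])
  qed
  have uniq: "\<Lambda> v = a" if "((\<lambda>f. f v) \<longlongrightarrow> a) G" for v a
    using tendsto_unique[OF _ lim that] ne by (simp add: G_def)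
  show thesis
  proof
    have "\<Lambda> (u + v) = \<Lambda> u + \<Lambda> v" for u v
      using ev[of "\<lambda>f. f u + f v = f (u + v)"] dual_ball_add[OF q]
      by (intro uniq Lim_transform_eventually[OF tendsto_add[OF lim lim]]) auto
    moreover have "\<Lambda> (s c v) = c * \<Lambda> v" for c v
      using ev[of "\<lambda>f. c * f v = f (s c v)"] dual_ball_scale[OF q]
      by (intro uniq Lim_transform_eventually[OF tendsto_mult[OF tendsto_const lim]]) auto
    moreover have "norm (\<Lambda> v) \<le> norm v" for v
      using \<open>\<Lambda> \<in> ?K\<close> by (auto simp: PiE_def Pi_def)
    ultimately show "\<Lambda> \<in> dual_ball s" by (simp add: dual_ball_iff)
  next
    fix v a assume "(\<lambda>n. q n v) \<longlonglongrightarrow> a"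
    then have "((\<lambda>f. f v) \<longlongrightarrow> a) (filtermap q sequentially)" by (simp add: filterlim_filtermap)
    then show "\<Lambda> v = a"
      by (intro uniq) (auto simp: G_def intro: tendsto_mono[OF inf_le2])
  qed
qed

end

section \<open>Support functionals of a smooth space\<close>

locale smooth_space = normed_space_over s
  for s :: "'k::real_or_complex \<Rightarrow> 'e::real_normed_vector \<Rightarrow> 'e" +
  assumes smooth: "smooth s"
begin

text \<open>
  Smoothness is a condition on the unit sphere and on bounded linear maps as a type; this is the
  same condition for all nonzero vectors and for plain functions.
\<close>

lemma ex1_support:
  assumes "e \<noteq> 0"
  shows "\<exists>!q. q \<in> dual_ball s \<and> q e = of_real (norm e)"
proof -
  define u where "u = e /\<^sub>R norm e"
  have u: "norm u = 1" "e = norm e *\<^sub>R u" using assms by (auto simp: u_def)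
  have iff: "q e = of_real (norm e) \<longleftrightarrow> q u = 1" if "q \<in> dual_ball s" for q
    using assms that by (subst u(2)) (simp add: dual_ball_scaleR)
  from smooth u(1) obtain f where f: "f \<in> dual s" "norm f = 1" "blinfun_apply f u = 1"
    and f_unique: "\<And>g. g \<in> dual s \<Longrightarrow> norm g = 1 \<Longrightarrow> blinfun_apply g u = 1 \<Longrightarrow> g = f"
    unfolding smooth_def by metis
  have ball: "blinfun_apply f \<in> dual_ball s"
    using f norm_blinfun[of f] by (auto simp: dual_ball_def dual_def)
  show ?thesis
  proof (intro ex1I conjI)
    show "blinfun_apply f \<in> dual_ball s" by (rule ball)
    show "blinfun_apply f e = of_real (norm e)" using f ball iff by blast
  next
    fix q assume q: "q \<in> dual_ball s \<and> q e = of_real (norm e)"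
    have "bounded_linear q"
      using q by (intro bounded_linear_intro[of _ 1])
        (auto simp: dual_ball_add dual_ball_scaleR dual_ball_le scaleR_conv_of_real)
    then have app: "blinfun_apply (Blinfun q) = q" by (rule bounded_linear_Blinfun_apply)
    have qu: "q u = 1" using q iff by blast
    have "norm (Blinfun q) \<le> 1"
      using q by (intro norm_blinfun_bound) (auto simp: app dual_ball_le)
    moreover have "norm (q u) \<le> norm (Blinfun q) * norm u" by (metis app norm_blinfun)
    ultimately have "norm (Blinfun q) = 1" using qu u by simp
    moreover have "Blinfun q \<in> dual s" using q by (simp add: dual_def app dual_ball_def)
    ultimately have "Blinfun q = f" using qu by (intro f_unique) (auto simp: app)
    then show "q = blinfun_apply f" using app by simp
  qed
qed

definition support :: "'e \<Rightarrow> 'e \<Rightarrow> 'k"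
  where "support e = (THE q. q \<in> dual_ball s \<and> q e = of_real (norm e))"

lemma
  assumes "e \<noteq> 0"
  shows support_ball: "support e \<in> dual_ball s" and support_self: "support e e = of_real (norm e)"
  using theI'[OF ex1_support[OF assms]] by (auto simp: support_def)

lemma support_eqI: "e \<noteq> 0 \<Longrightarrow> q \<in> dual_ball s \<Longrightarrow> q e = of_real (norm e) \<Longrightarrow> support e = q"
  using ex1_support support_ball support_self by blast

lemma support_minus:
  assumes "e \<noteq> 0"
  shows "support (- e) v = - support e v"
proof -
  have "(\<lambda>v. - support e v) \<in> dual_ball s"
    using support_ball[OF assms] by (auto simp: dual_ball_iff)
  then have "support (- e) = (\<lambda>v. - support e v)"
    using assms by (intro support_eqI) (auto simp: dual_ball_minus support_ball support_self)
  then show ?thesis by simp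
qed

text \<open>
  Smoothness makes the support functional norm-to-weak* continuous: a cluster point of support
  functionals at points tending to \<open>e\<close> supports \<open>e\<close>, hence is the one there is.\<close>

lemma support_limit:
  assumes e: "es \<longlonglongrightarrow> e" "e \<noteq> 0" "\<And>n. es n \<noteq> 0" and v: "vs \<longlonglongrightarrow> v"
    and a: "(\<lambda>n. support (es n) (vs n)) \<longlonglongrightarrow> a"
  shows "support e v = a"
proof -
  obtain \<Lambda> where \<Lambda>: "\<Lambda> \<in> dual_ball s"
    and lim: "\<And>v a. (\<lambda>n. support (es n) v) \<longlonglongrightarrow> a \<Longrightarrow> \<Lambda> v = a"
    using dual_ball_cluster[of "\<lambda>n. support (es n)"] support_ball e(3) by blast
  \<comment> \<open>The functionals are equicontinuous, so moving arguments may be replaced by their limit.\<close>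
  have fixed: "\<Lambda> w = b" if w: "ws \<longlonglongrightarrow> w" and b: "(\<lambda>n. support (es n) (ws n)) \<longlonglongrightarrow> b" for ws w b
  proof (rule lim)
    have "(\<lambda>n. support (es n) (w - ws n)) \<longlonglongrightarrow> 0"
    proof (rule Lim_null_comparison)
      show "\<forall>\<^sub>F n in sequentially. norm (support (es n) (w - ws n)) \<le> norm (w - ws n)"
        using dual_ball_le[OF support_ball[OF e(3)]] by simp
      show "(\<lambda>n. norm (w - ws n)) \<longlonglongrightarrow> 0"
        using tendsto_norm[OF tendsto_diff[OF tendsto_const[of w] w]] by simp
    qed
    then have "(\<lambda>n. support (es n) (w - ws n) + support (es n) (ws n)) \<longlonglongrightarrow> 0 + b"
      using b by (rule tendsto_add)
    then show "(\<lambda>n. support (es n) w) \<longlonglongrightarrow> b"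
      by (simp add: support_ball e(3) flip: dual_ball_add)
  qed
  have "\<Lambda> e = of_real (norm e)"
    using e by (intro fixed[OF e(1)]) (auto simp: support_self intro!: tendsto_intros)
  then have "support e = \<Lambda>" using e \<Lambda> by (intro support_eqI) auto
  moreover have "\<Lambda> v = a" by (rule fixed[OF v a])
  ultimately show ?thesis by simp
qed

text \<open>
  The unit sphere of a smooth space contains no corner. Under the assumption the normalised
  vectors span a plane in which their sum has norm one, as the corner of the square does for the
  maximum norm, and is supported by two different functionals, those of \<open>v\<close> and of \<open>w\<close>.
\<close>

lemma support_not_disjoint:
  assumes nz: "v \<noteq> 0" "w \<noteq> 0"
    and disj: "\<And>e. e \<noteq> 0 \<Longrightarrow> support e v = 0 \<or> support e w = 0"
  shows False
proof -
  define v1 where "v1 = v /\<^sub>R norm v"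
  define w1 where "w1 = w /\<^sub>R norm w"
  have norm: "norm v1 = 1" "norm w1 = 1" and nz1: "v1 \<noteq> 0" "w1 \<noteq> 0"
    using nz by (auto simp: v1_def w1_def)
  have disj1: "support e v1 = 0 \<or> support e w1 = 0" if "e \<noteq> 0" for e
    using disj[OF that] support_ball[OF that] by (auto simp: v1_def w1_def dual_ball_scaleR)
  have sv: "support v1 v1 = 1" "support v1 w1 = 0" and sw: "support w1 w1 = 1" "support w1 v1 = 0"
    using disj1 nz1 norm support_self by force+
  have sum: "support v1 (v1 + w1) = 1" "support w1 (v1 + w1) = 1"
    using sv sw nz1 by (auto simp: dual_ball_add support_ball)
  then have nz2: "v1 + w1 \<noteq> 0" using nz1 by (metis dual_ball_zero support_ball zero_neq_one)
  have "norm (v1 + w1) = norm (support (v1 + w1) v1 + support (v1 + w1) w1)"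
    using support_self[OF nz2] support_ball[OF nz2] by (simp flip: dual_ball_add)
  also have "\<dots> \<le> 1"
    using disj1[OF nz2] dual_ball_le[OF support_ball[OF nz2], of v1]
      dual_ball_le[OF support_ball[OF nz2], of w1] norm by auto
  finally have "norm (v1 + w1) \<le> 1" .
  moreover have "norm (v1 + w1) \<ge> 1"
    using sum dual_ball_le[OF support_ball[OF nz1(1)], of "v1 + w1"] by simp
  ultimately have "norm (v1 + w1) = 1" by simp
  then have "support (v1 + w1) = support v1" "support (v1 + w1) = support w1"
    using sum nz1 nz2 by (auto intro!: support_eqI support_ball)
  then show False using sv sw by simp
qed

end

section \<open>Constant functions, bumps and peaks\<close>

lemma apply_lip_le: "norm (apply_lip f x) \<le> norm f"
  using norm_lip_le_iff[of f "norm f"] by simp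

lemma apply_lip_diff_le: "norm (apply_lip f x - apply_lip f y) \<le> norm f * dist x y"
  using norm_lip_le_iff[of f "norm f"] by (auto simp: lipschitz_on_def dist_norm)

lemma continuous_apply_lip: "continuous_on S (apply_lip f)"
  using apply_lip[of f] by (auto intro: lipschitz_on_continuous_on lipschitz_on_subset)

lift_definition const_lip :: "'e::real_normed_vector \<Rightarrow> ('x::metric_space, 'e) lip" is "\<lambda>e _. e"
  by (auto intro: lipschitz_on_constant)

lemma bump_lipschitz:
  fixes e :: "'e::real_normed_vector"
  shows "(norm e)-lipschitz_on UNIV (\<lambda>z. max 0 (r - dist z x) *\<^sub>R e)"
proof (rule lipschitz_onI)
  fix y z
  have "\<bar>max 0 (r - dist y x) - max 0 (r - dist z x)\<bar> \<le> dist y z"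
    using dist_triangle[of y x z] dist_triangle[of z x y] dist_commute[of y z] by linarith
  then show "dist (max 0 (r - dist y x) *\<^sub>R e) (max 0 (r - dist z x) *\<^sub>R e) \<le> norm e * dist y z"
    by (simp add: dist_norm mult.commute mult_left_mono flip: scaleR_left_diff_distrib)
qed simp

lift_definition bump_lip :: "'x::metric_space \<Rightarrow> real \<Rightarrow> 'e::real_normed_vector \<Rightarrow> ('x, 'e) lip"
  is "\<lambda>x r e z. max 0 (r - dist z x) *\<^sub>R e"
proof safe
  fix x :: 'x and r and e :: 'e
  have "max 0 (r - dist z x) \<le> max 0 r" for z
    by (rule max.mono) auto
  then have "norm (max 0 (r - dist z x) *\<^sub>R e) \<le> max 0 r * norm e" for z
    by (simp add: mult_right_mono)
  then show "bounded (range (\<lambda>z. max 0 (r - dist z x) *\<^sub>R e))"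
    by (auto simp: bounded_iff)
qed (use bump_lipschitz in blast)

lemmas [simp] = const_lip.rep_eq bump_lip.rep_eq

definition peak_lip :: "'x::metric_space \<Rightarrow> 'e::real_normed_vector \<Rightarrow> ('x, 'e) lip"
  where "peak_lip x e = const_lip e + bump_lip x 1 e"

lemma apply_peak_lip: "apply_lip (peak_lip x e) z = (1 + max 0 (1 - dist z x)) *\<^sub>R e"
  by (simp add: peak_lip_def scaleR_left_distrib)

lemma norm_const_lip: "norm (const_lip e) = norm e"
proof (rule antisym)
  show "norm (const_lip e) \<le> norm e"
    by (auto simp: norm_lip_le_iff lipschitz_on_def)
  show "norm e \<le> norm (const_lip e)"
    using apply_lip_le[of "const_lip e"] by simp
qed

lemma const_lip_diff: "const_lip (u - v) = const_lip u - const_lip v"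
  by (rule lip_eqI) simp

text \<open>
  The slope of the peak leaves room for a perturbation vanishing at its summit: such a
  perturbation grows no faster than the peak falls.\<close>

lemma norm_peak_lip_add_le:
  assumes g: "apply_lip g y = 0" "norm g \<le> norm e"
  shows "norm (peak_lip y e + g) \<le> 2 * norm e"
  unfolding norm_lip_le_iff
proof
  have "(norm g)-lipschitz_on UNIV (apply_lip g)" using norm_lip_le_iff[of g "norm g"] by simp
  then have "(0 + norm e + norm g)-lipschitz_on UNIV
      (\<lambda>z. e + max 0 (1 - dist z y) *\<^sub>R e + apply_lip g z)"
    by (intro lipschitz_on_add lipschitz_on_constant bump_lipschitz)
  then have "(2 * norm e)-lipschitz_on UNIV
      (\<lambda>z. e + max 0 (1 - dist z y) *\<^sub>R e + apply_lip g z)"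
    by (rule lipschitz_on_mono) (use g in auto)
  then show "(2 * norm e)-lipschitz_on UNIV (apply_lip (peak_lip y e + g))"
    by (simp add: peak_lip_def)
  show "\<forall>z. norm (apply_lip (peak_lip y e + g) z) \<le> 2 * norm e"
  proof
    fix z
    have "norm (apply_lip g z) \<le> norm e * dist z y"
      using apply_lip_diff_le[of g z y] g mult_right_mono[OF g(2), of "dist z y"] by simp
    moreover have "norm (apply_lip g z) \<le> norm e"
      using apply_lip_le[of g z] g by simp
    ultimately have "norm (apply_lip g z) \<le> (1 - max 0 (1 - dist z y)) * norm e"
      by (auto simp: max_def mult.commute)
    moreover have "norm (apply_lip (peak_lip y e) z) = (1 + max 0 (1 - dist z y)) * norm e"
      by (simp add: apply_peak_lip)
    ultimately have "norm (apply_lip (peak_lip y e) z) + norm (apply_lip g z) \<le> 2 * norm e"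
      by (simp add: algebra_simps)
    then show "norm (apply_lip (peak_lip y e + g) z) \<le> 2 * norm e"
      using norm_triangle_le[of "apply_lip (peak_lip y e) z"] by simp
  qed
qed

lemma norm_peak_lip: "norm (peak_lip y e) = 2 * norm e"
proof (rule antisym)
  show "norm (peak_lip y e) \<le> 2 * norm e"
    using norm_peak_lip_add_le[of 0 y e] by simp
  show "2 * norm e \<le> norm (peak_lip y e)"
    using apply_lip_le[of "peak_lip y e" y] by (simp add: apply_peak_lip)
qed

lemma norm_apply_peak_lip_eq_iff:
  assumes "e \<noteq> 0"
  shows "norm (apply_lip (peak_lip x e) z) = 2 * norm e \<longleftrightarrow> z = x"
proof -
  have "norm (apply_lip (peak_lip x e) z) = (1 + max 0 (1 - dist z x)) * norm e"
    by (simp add: apply_peak_lip)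
  then show ?thesis using assms by (auto simp: max_def)
qed

section \<open>Surjective linear isometries\<close>

lemma
  assumes "T \<in> Iso s1 s2"
  shows Iso_add: "T (u + v) = T u + T v" and Iso_scale: "T (s1 c v) = s2 c (T v)"
    and Iso_norm: "norm (T v) = norm v" and Iso_surj: "surj T"
    and Iso_diff: "T (u - v) = T u - T v" and Iso_zero: "T 0 = 0"
proof -
  show add: "T (u + v) = T u + T v" for u v
    using assms by (simp add: Iso_def Vector_Spaces.linear_iff)
  interpret T: additive T by standard (rule add)
  show "T (s1 c v) = s2 c (T v)" "norm (T v) = norm v" "surj T"
    using assms by (auto simp: Iso_def Vector_Spaces.linear_iff)
  show "T (u - v) = T u - T v" "T 0 = 0" by (rule T.diff T.zero)+
qed

lemma IsoI:
  assumes "normed_space_over s1" "normed_space_over s2"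
    and "\<And>u v. T (u + v) = T u + T v" "\<And>c v. T (s1 c v) = s2 c (T v)"
    and "\<And>v. norm (T v) = norm v" "surj T"
  shows "T \<in> Iso s1 s2"
  using assms by (auto simp: Iso_def Vector_Spaces.linear_iff normed_space_over_def)

lemma Iso_bij:
  assumes T: "T \<in> Iso s1 s2"
  shows "bij T"
proof (rule bijI)
  show "inj T"
  proof (rule injI)
    fix u v assume "T u = T v"
    then have "norm (u - v) = 0" using Iso_norm[OF T, of "u - v"] Iso_diff[OF T] by simp
    then show "u = v" by simp
  qed
qed (rule Iso_surj[OF T])

lemma
  assumes T: "T \<in> Iso s1 s2"
  shows Iso_inv_left: "inv T (T v) = v" and Iso_inv_right: "T (inv T w) = w"
  using Iso_bij[OF T] by (auto simp: bij_is_inj bij_is_surj surj_f_inv_f)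

lemma Iso_inv:
  assumes T: "T \<in> Iso s1 s2"
  shows "inv T \<in> Iso s2 s1"
proof -
  note inv = Iso_inv_left[OF T] Iso_inv_right[OF T]
  have "inv T (u + v) = inv T u + inv T v" for u v
    by (metis inv Iso_add[OF T])
  moreover have "inv T (s2 c v) = s1 c (inv T v)" for c v
    by (metis inv Iso_scale[OF T])
  moreover have "norm (inv T v) = norm v" for v
    by (metis inv Iso_norm[OF T])
  moreover have "surj (inv T)"
    by (metis inv(1) surjI)
  ultimately show ?thesis
    using T by (simp add: Iso_def Vector_Spaces.linear_iff)
qed

lemma dual_ball_compose_Iso:
  assumes s1: "normed_space_over s1" and s2: "normed_space_over s2"
    and T: "T \<in> Iso s1 s2" and q: "q \<in> dual_ball s2"
  shows "(\<lambda>v. q (T v)) \<in> dual_ball s1"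
  using normed_space_over.dual_ball_le[OF s2 q]
  by (simp add: normed_space_over.dual_ball_iff[OF s1] Iso_add[OF T] Iso_scale[OF T]
      normed_space_over.dual_ball_add[OF s2 q] normed_space_over.dual_ball_scale[OF s2 q])
    (metis Iso_norm[OF T])

context normed_space_over
begin

lemma dual_ball_point:
  assumes q: "q \<in> dual_ball s"
  shows "(\<lambda>f. q (apply_lip f x)) \<in> dual_ball (scale_lip s)"
  unfolding normed_space_over.dual_ball_iff[OF normed_space_over_lip]
  using order_trans[OF dual_ball_le[OF q] apply_lip_le]
  by (auto simp: apply_scale_lip dual_ball_add[OF q] dual_ball_scale[OF q])

lemma dual_ball_molecule:
  assumes q: "q \<in> dual_ball s" and "x \<noteq> y"
  shows "(\<lambda>f. q (apply_lip f x - apply_lip f y) / of_real (dist x y)) \<in> dual_ball (scale_lip s)"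
  unfolding normed_space_over.dual_ball_iff[OF normed_space_over_lip]
proof (intro conjI allI)
  fix f :: "('a, 'e) lip"
  have "norm (q (apply_lip f x - apply_lip f y)) \<le> norm f * dist x y"
    by (rule order_trans[OF dual_ball_le[OF q] apply_lip_diff_le])
  then show "norm (q (apply_lip f x - apply_lip f y) / of_real (dist x y)) \<le> norm f"
    using \<open>x \<noteq> y\<close> by (simp add: norm_divide divide_le_eq)
qed (auto simp: apply_scale_lip dual_ball_add[OF q] dual_ball_scale[OF q] dual_ball_diff[OF q]
      algebra_simps diff_divide_distrib add_divide_distrib)

end

section \<open>Transported point functionals are of point or of derivation type\<close>

context smooth_space
begin

text \<open>
  Perturbing the peak by a function \<open>g\<close> vanishing at \<open>y\<close>, multiplied by a scalar that turns
  \<open>\<Lambda>(g)\<close> into a positive number, does not increase the norm, so \<open>\<Lambda>(g) = 0\<close>. Thus \<open>\<Lambda>\<close>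
  sees only the value at \<open>y\<close>, and does so through a functional on \<open>E\<close> that supports \<open>e\<close>.
\<close>

lemma functional_attaining_peak:
  assumes \<Lambda>: "\<Lambda> \<in> dual_ball (scale_lip s)" and e: "e \<noteq> 0"
    and peak: "\<Lambda> (peak_lip y e) = of_real (2 * norm e)"
  shows "\<Lambda> g = support e (apply_lip g y)"
proof -
  interpret lip: normed_space_over "scale_lip s" by (rule normed_space_over_lip)
  note lin = lip.dual_ball_add[OF \<Lambda>] lip.dual_ball_diff[OF \<Lambda>] lip.dual_ball_scale[OF \<Lambda>]
    lip.dual_ball_scaleR[OF \<Lambda>]
  have vanish: "\<Lambda> g = 0" if "apply_lip g y = 0" for g
  proof (rule ccontr)
    assume "\<Lambda> g \<noteq> 0"
    then have nz: "g \<noteq> 0" using lip.dual_ball_zero[OF \<Lambda>] by auto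
    \<comment> \<open>\<open>c\<close> rotates \<open>\<Lambda>(g)\<close> to the positive axis and scales \<open>g\<close> to the norm of \<open>e\<close>.\<close>
    define c where "c = of_real (norm e / norm g) * (of_real (norm (\<Lambda> g)) / \<Lambda> g)"
    have c: "norm c = norm e / norm g" using \<open>\<Lambda> g \<noteq> 0\<close> by (simp add: c_def norm_mult norm_divide)
    have "norm (peak_lip y e + scale_lip s c g) \<le> 2 * norm e"
      using that nz by (intro norm_peak_lip_add_le) (auto simp: apply_scale_lip lip.norm_scale c)
    then have "norm (\<Lambda> (peak_lip y e + scale_lip s c g)) \<le> 2 * norm e"
      using lip.dual_ball_le[OF \<Lambda>] order_trans by blast
    moreover have "\<Lambda> (peak_lip y e + scale_lip s c g)
        = of_real (2 * norm e + norm e / norm g * norm (\<Lambda> g))"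
      using \<open>\<Lambda> g \<noteq> 0\<close> by (simp add: lin peak c_def)
    ultimately have "\<bar>2 * norm e + norm e / norm g * norm (\<Lambda> g)\<bar> \<le> 2 * norm e"
      by (metis norm_of_real)
    moreover have "norm e / norm g * norm (\<Lambda> g) > 0" using e nz \<open>\<Lambda> g \<noteq> 0\<close> by simp
    ultimately show False by linarith
  qed
  have at: "\<Lambda> g = \<Lambda> (const_lip (apply_lip g y))" for g
    using vanish[of "g - const_lip (apply_lip g y)"] by (simp add: lin)
  have "(\<lambda>v. \<Lambda> (const_lip v)) \<in> dual_ball s"
    unfolding dual_ball_iff
  proof (intro conjI allI)
    fix u v c
    show "\<Lambda> (const_lip (u + v)) = \<Lambda> (const_lip u) + \<Lambda> (const_lip v)"
      by (subst lin(1)[symmetric]) (auto intro!: arg_cong[of _ _ \<Lambda>] lip_eqI)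
    show "\<Lambda> (const_lip (s c v)) = c * \<Lambda> (const_lip v)"
      by (subst lin(3)[symmetric]) (auto intro!: arg_cong[of _ _ \<Lambda>] lip_eqI simp: apply_scale_lip)
    show "norm (\<Lambda> (const_lip v)) \<le> norm v"
      using lip.dual_ball_le[OF \<Lambda>, of "const_lip v"] by (simp add: norm_const_lip)
  qed
  moreover have "\<Lambda> (const_lip e) = of_real (norm e)"
  proof -
    have "const_lip (apply_lip (peak_lip y e) y) = (2::real) *\<^sub>R const_lip e"
      by (rule lip_eqI) (simp add: apply_peak_lip)
    then have "of_real 2 * \<Lambda> (const_lip e) = of_real (2 * norm e)"
      using peak at[of "peak_lip y e"] lin(4)[of 2 "const_lip e"] by metis
    then show ?thesis by simp
  qed
  ultimately have "support e = (\<lambda>v. \<Lambda> (const_lip v))" using e by (intro support_eqI)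
  then show ?thesis using at by simp
qed

text \<open>
  The two ways in which the isometry \<open>T\<close> can pull back the functional \<open>g \<mapsto> support e (g(y))\<close>: to
  a functional that looks at a single point, or to one that, like a limit of difference
  quotients, annihilates constants.
\<close>

definition point_type ::
  "(('x::metric_space, 'e) lip \<Rightarrow> ('y::metric_space, 'e) lip) \<Rightarrow> 'y \<Rightarrow> 'e \<Rightarrow> bool"
  where "point_type T y e \<longleftrightarrow>
    (\<exists>x. \<exists>q \<in> dual_ball s. \<forall>g. support e (apply_lip (T g) y) = q (apply_lip g x))"

definition derivation_type ::
  "(('x::metric_space, 'e) lip \<Rightarrow> ('y::metric_space, 'e) lip) \<Rightarrow> 'y \<Rightarrow> 'e \<Rightarrow> bool"
  where "derivation_type T y e \<longleftrightarrow> (\<forall>c. support e (apply_lip (T (const_lip c)) y) = 0)"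

text \<open>
  Let \<open>H\<close> be the preimage of the peak at \<open>y\<close>. If \<open>H\<close> attains its norm as a uniform norm at \<open>x\<close>, the
  functional supporting \<open>H(x)\<close>, evaluated at \<open>x\<close>, attains its norm at the peak. Otherwise
  the norm of \<open>H\<close> is its Lipschitz constant, and difference quotients nearly attain it; their
  cluster point attains it and kills the images of constants. In both cases the functional so
  found is the evaluation of \<open>support e\<close> at \<open>y\<close>, by the uniqueness at the peak.
\<close>

lemma point_or_derivation_type:
  fixes T :: "('x::metric_space, 'e) lip \<Rightarrow> ('y::metric_space, 'e) lip"
  assumes X: "compact (UNIV :: 'x set)" and T: "T \<in> Iso (scale_lip s) (scale_lip s)"
    and e: "e \<noteq> 0"
  shows "point_type T y e \<or> derivation_type T y e"
proof -
  interpret Lip: normed_space_over "scale_lip s :: 'k \<Rightarrow> ('y, 'e) lip \<Rightarrow> _"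
    by (rule normed_space_over_lip)
  note U = Iso_inv[OF T]
  define H where "H = inv T (peak_lip y e)"
  have norm_H: "norm H = 2 * norm e" by (simp add: H_def Iso_norm[OF U] norm_peak_lip)
  obtain x where x: "\<And>x'. norm (apply_lip H x') \<le> norm (apply_lip H x)"
    using continuous_attains_sup[OF X, of "\<lambda>x. norm (apply_lip H x)"]
      continuous_on_norm[OF continuous_apply_lip[of UNIV H]] by auto
  show ?thesis
  proof (cases "norm (apply_lip H x) = 2 * norm e")
    case True
    then have nz: "apply_lip H x \<noteq> 0" using e by auto
    let ?q = "support (apply_lip H x)"
    let ?\<Lambda> = "\<lambda>g. ?q (apply_lip (inv T g) x)"
    have "?\<Lambda> \<in> dual_ball (scale_lip s)"
      by (rule dual_ball_compose_Iso[OF normed_space_over_lip normed_space_over_lip U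
            dual_ball_point[OF support_ball[OF nz]]])
    moreover have "?\<Lambda> (peak_lip y e) = of_real (2 * norm e)"
      using True support_self[OF nz] by (simp flip: H_def)
    ultimately have "?\<Lambda> g = support e (apply_lip g y)" for g
      using e by (intro functional_attaining_peak)
    from this[of "T _"] have "support e (apply_lip (T g) y) = ?q (apply_lip g x)" for g
      by (simp add: Iso_inv_left[OF T])
    then show ?thesis using support_ball[OF nz] unfolding point_type_def by blast
  next
    case False
    then have less: "norm (apply_lip H x) < 2 * norm e" using apply_lip_le[of H x] norm_H by simp
    have "\<exists>\<Lambda>. \<Lambda> \<in> dual_ball (scale_lip s) \<and> (\<forall>c. \<Lambda> (T (const_lip c)) = 0) \<and>
        norm (\<Lambda> (peak_lip y e) - of_real (2 * norm e)) \<le> 1 / real (Suc n)" for n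
    proof -
      \<comment> \<open>As \<open>K\<close> bounds the values of \<open>H\<close> but not its norm, it is not a Lipschitz constant of \<open>H\<close>.\<close>
      define K where "K = max (norm (apply_lip H x)) (2 * norm e - 1 / real (Suc n))"
      have K: "0 \<le> K" "K < 2 * norm e" "2 * norm e - K \<le> 1 / real (Suc n)"
        using less by (auto simp: K_def le_max_iff_disj)
      have "norm (apply_lip H x') \<le> K" for x' using x[of x'] by (simp add: K_def)
      then have "\<not> K-lipschitz_on UNIV (apply_lip H)"
        using norm_lip_le_iff[of H K] norm_H K by auto
      then obtain u v where uv: "K * dist u v < norm (apply_lip H u - apply_lip H v)"
        using K(1) by (auto simp: lipschitz_on_def dist_norm not_le)
      then have "u \<noteq> v" by auto
      have nz: "apply_lip H u - apply_lip H v \<noteq> 0"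
        using uv mult_nonneg_nonneg[OF K(1) zero_le_dist[of u v]] by force
      let ?q = "support (apply_lip H u - apply_lip H v)"
      let ?\<Lambda> = "\<lambda>g. ?q (apply_lip (inv T g) u - apply_lip (inv T g) v) / of_real (dist u v)"
      let ?r = "norm (apply_lip H u - apply_lip H v) / dist u v"
      have "K < ?r" "?r \<le> 2 * norm e"
        using uv \<open>u \<noteq> v\<close> apply_lip_diff_le[of H u v] by (auto simp: norm_H less_divide_eq divide_le_eq)
      then have "\<bar>?r - 2 * norm e\<bar> \<le> 1 / real (Suc n)" using K by auto
      moreover have "?\<Lambda> (peak_lip y e) - of_real (2 * norm e) = of_real (?r - 2 * norm e)"
        using support_self[OF nz] by (simp flip: H_def)
      ultimately have "norm (?\<Lambda> (peak_lip y e) - of_real (2 * norm e)) \<le> 1 / real (Suc n)"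
        by (metis norm_of_real)
      moreover have "?\<Lambda> \<in> dual_ball (scale_lip s)"
        by (rule dual_ball_compose_Iso[OF normed_space_over_lip normed_space_over_lip U
              dual_ball_molecule[OF support_ball[OF nz] \<open>u \<noteq> v\<close>]])
      moreover have "?\<Lambda> (T (const_lip c)) = 0" for c
        by (simp add: Iso_inv_left[OF T] dual_ball_zero[OF support_ball[OF nz]])
      ultimately show ?thesis by blast
    qed
    then obtain \<Lambda> where \<Lambda>: "\<And>n. \<Lambda> n \<in> dual_ball (scale_lip s)"
      and const: "\<And>n c. \<Lambda> n (T (const_lip c)) = 0"
      and peak: "\<And>n. norm (\<Lambda> n (peak_lip y e) - of_real (2 * norm e)) \<le> 1 / real (Suc n)"
      by metis
    obtain \<Lambda>' where \<Lambda>': "\<Lambda>' \<in> dual_ball (scale_lip s)"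
      and lim: "\<And>g a. (\<lambda>n. \<Lambda> n g) \<longlonglongrightarrow> a \<Longrightarrow> \<Lambda>' g = a"
      by (rule Lip.dual_ball_cluster[OF \<Lambda>]) (rule that)
    have "(\<lambda>n. \<Lambda> n (peak_lip y e) - of_real (2 * norm e)) \<longlonglongrightarrow> 0"
      by (rule Lim_null_comparison[OF _ LIMSEQ_Suc[OF lim_1_over_n]]) (use peak in auto)
    then have "\<Lambda>' (peak_lip y e) = of_real (2 * norm e)"
      by (rule lim[OF LIM_zero_cancel])
    moreover have "\<Lambda>' (T (const_lip c)) = 0" for c by (rule lim) (simp add: const)
    ultimately have "support e (apply_lip (T (const_lip c)) y) = 0" for c
      using functional_attaining_peak[OF \<Lambda>' e] by metis
    then show ?thesis by (simp add: derivation_type_def)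
  qed
qed

end

section \<open>Connectedness excludes the derivation type\<close>

lemma tendsto_apply_lip:
  assumes f: "fs \<longlonglongrightarrow> f" and x: "xs \<longlonglongrightarrow> x"
  shows "(\<lambda>n. apply_lip (fs n) (xs n)) \<longlonglongrightarrow> apply_lip f x"
proof -
  have "(\<lambda>n. norm (fs n - f)) \<longlonglongrightarrow> 0"
    using f by (simp add: LIM_zero tendsto_norm_zero)
  moreover have "norm (apply_lip (fs n) (xs n) - apply_lip f (xs n)) \<le> norm (fs n - f)" for n
    using apply_lip_le[of "fs n - f" "xs n"] by simp
  ultimately have "(\<lambda>n. apply_lip (fs n) (xs n) - apply_lip f (xs n)) \<longlonglongrightarrow> 0"
    by (rule Lim_null_comparison[OF always_eventually[OF allI], rotated])
  moreover have "(\<lambda>n. apply_lip f (xs n)) \<longlonglongrightarrow> apply_lip f x"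
    using continuous_on_tendsto_compose[OF continuous_apply_lip[of UNIV f] x] by simp
  ultimately have "(\<lambda>n. apply_lip (fs n) (xs n) - apply_lip f (xs n) + apply_lip f (xs n))
      \<longlonglongrightarrow> 0 + apply_lip f x"
    by (rule tendsto_add)
  then show ?thesis by simp
qed

lemma tendsto_Iso:
  assumes T: "T \<in> Iso s1 s2" and "vs \<longlonglongrightarrow> v"
  shows "(\<lambda>n. T (vs n)) \<longlonglongrightarrow> T v"
proof -
  have "(\<lambda>n. norm (vs n - v)) \<longlonglongrightarrow> 0"
    using assms by (simp add: LIM_zero tendsto_norm_zero)
  moreover have "norm (T (vs n) - T v) = norm (vs n - v)" for n
    by (metis Iso_diff[OF T] Iso_norm[OF T])
  ultimately have "(\<lambda>n. norm (T (vs n) - T v)) \<longlonglongrightarrow> 0" by simp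
  then show ?thesis by (simp add: tendsto_norm_zero_iff LIM_zero_iff)
qed

lemma tendsto_const_lip:
  assumes "es \<longlonglongrightarrow> e"
  shows "(\<lambda>n. const_lip (es n)) \<longlonglongrightarrow> const_lip e"
proof -
  have "(\<lambda>n. norm (es n - e)) \<longlonglongrightarrow> 0"
    using assms by (simp add: LIM_zero tendsto_norm_zero)
  then have "(\<lambda>n. norm (const_lip (es n) - const_lip e)) \<longlonglongrightarrow> 0"
    by (simp add: norm_const_lip flip: const_lip_diff)
  then show ?thesis by (simp add: tendsto_norm_zero_iff LIM_zero_iff)
qed

context smooth_space
begin

lemma point_typeE:
  assumes "point_type T y e"
  obtains x q where "q \<in> dual_ball s"
    and "\<And>g. support e (apply_lip (T g) y) = q (apply_lip g x)"
proof -
  from assms obtain x where "\<exists>q\<in>dual_ball s. \<forall>g. support e (apply_lip (T g) y) = q (apply_lip g x)"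
    unfolding point_type_def ..
  then obtain q where "q \<in> dual_ball s" "\<forall>g. support e (apply_lip (T g) y) = q (apply_lip g x)" ..
  then show thesis by (intro that[of q x]) simp_all
qed

text \<open>
  Applied to constant sequences, this says that the two types exclude each other. At a pair
  \<open>(y, e)\<close> of point type with point \<open>x\<close>, let \<open>c\<close> be the value at \<open>x\<close> of the preimage of the constant
  \<open>e\<close>; then \<open>support e\<close> takes the value \<open>\<parallel>e\<parallel>\<close> at \<open>T (const_lip c) (y)\<close>. As \<open>X\<close> is compact, this
  identity passes to the limit, where it contradicts the derivation type.
\<close>

lemma point_type_limit:
  fixes T :: "('x::metric_space, 'e) lip \<Rightarrow> ('y::metric_space, 'e) lip"
  assumes X: "compact (UNIV :: 'x set)" and T: "T \<in> Iso (scale_lip s) (scale_lip s)"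
    and e: "es \<longlonglongrightarrow> e" "e \<noteq> 0" "\<And>n. es n \<noteq> 0" and y: "ys \<longlonglongrightarrow> y"
    and point: "\<And>n. point_type T (ys n) (es n)"
  shows "\<not> derivation_type T y e"
proof
  assume deriv: "derivation_type T y e"
  obtain xs q where
    eq: "\<And>n g. support (es n) (apply_lip (T g) (ys n)) = q n (apply_lip g (xs n))"
    using point unfolding point_type_def by metis
  obtain r x where r: "strict_mono r" and x: "(xs \<circ> r) \<longlonglongrightarrow> x"
    using X unfolding compact_def by (metis UNIV_I)
  define c where "c n = apply_lip (inv T (const_lip (es n))) (xs n)" for n
  \<comment> \<open>The constants \<open>c n\<close> are chosen as values of preimages, hence converge along \<open>r\<close>.\<close>
  have norm_es: "support (es n) (apply_lip (T (const_lip (c n))) (ys n)) = of_real (norm (es n))" for n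
    using eq[of n "inv T (const_lip (es n))"] eq[of n "const_lip (c n)"] support_self[OF e(3)]
    by (simp add: c_def Iso_inv_right[OF T])
  have er: "(es \<circ> r) \<longlonglongrightarrow> e" and yr: "(ys \<circ> r) \<longlonglongrightarrow> y"
    using e(1) y r by (auto intro: LIMSEQ_subseq_LIMSEQ)
  let ?c = "apply_lip (inv T (const_lip e)) x"
  have "(\<lambda>n. apply_lip (inv T (const_lip ((es \<circ> r) n))) ((xs \<circ> r) n)) \<longlonglongrightarrow> ?c"
    by (intro tendsto_apply_lip tendsto_Iso[OF Iso_inv[OF T]] tendsto_const_lip er x)
  then have "(\<lambda>n. c (r n)) \<longlonglongrightarrow> ?c" by (simp add: c_def)
  then have "(\<lambda>n. apply_lip (T (const_lip (c (r n)))) ((ys \<circ> r) n)) \<longlonglongrightarrow> apply_lip (T (const_lip ?c)) y"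
    by (intro tendsto_apply_lip tendsto_Iso[OF T] tendsto_const_lip yr)
  moreover have "(\<lambda>n. support ((es \<circ> r) n) (apply_lip (T (const_lip (c (r n)))) ((ys \<circ> r) n)))
      \<longlonglongrightarrow> of_real (norm e)"
    using tendsto_of_real[OF tendsto_norm[OF er]] by (simp add: norm_es)
  ultimately have "support e (apply_lip (T (const_lip ?c)) y) = of_real (norm e)"
    using e by (intro support_limit[OF er]) auto
  then show False using deriv e(2) by (simp add: derivation_type_def)
qed

lemma derivation_type_limit:
  assumes T: "T \<in> Iso (scale_lip s) (scale_lip s)"
    and e: "es \<longlonglongrightarrow> e" "e \<noteq> 0" "\<And>n. es n \<noteq> 0" and y: "ys \<longlonglongrightarrow> y"
    and deriv: "\<And>n. derivation_type T (ys n) (es n)"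
  shows "derivation_type T y e"
  unfolding derivation_type_def
proof
  fix c
  have "(\<lambda>n. apply_lip (T (const_lip c)) (ys n)) \<longlonglongrightarrow> apply_lip (T (const_lip c)) y"
    by (rule tendsto_apply_lip[OF tendsto_const y])
  moreover have "(\<lambda>n. support (es n) (apply_lip (T (const_lip c)) (ys n))) \<longlonglongrightarrow> 0"
    using deriv by (simp add: derivation_type_def)
  ultimately show "support e (apply_lip (T (const_lip c)) y) = 0"
    by (rule support_limit[OF e])
qed

text \<open>
  A connectedness argument on the product of \<open>Y\<close> with the segment, which the two types
  partition into two closed sets.
\<close>

lemma point_type_along_segment:
  fixes T :: "('x::metric_space, 'e) lip \<Rightarrow> ('y::metric_space, 'e) lip"
  assumes X: "compact (UNIV :: 'x set)" and Y: "connected (UNIV :: 'y set)"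
    and T: "T \<in> Iso (scale_lip s) (scale_lip s)"
    and nz: "0 \<notin> closed_segment e\<^sub>1 e\<^sub>2" and point: "point_type T y\<^sub>1 e\<^sub>1"
  shows "\<not> derivation_type T y\<^sub>2 e\<^sub>2"
proof
  assume deriv: "derivation_type T y\<^sub>2 e\<^sub>2"
  let ?S = "(UNIV :: 'y set) \<times> closed_segment e\<^sub>1 e\<^sub>2"
  let ?P = "{p \<in> ?S. point_type T (fst p) (snd p)}"
  let ?D = "{p \<in> ?S. derivation_type T (fst p) (snd p)}"
  have disj: "\<not> derivation_type T y e" if "point_type T y e" "e \<noteq> 0" for y e
    using that by (intro point_type_limit[OF X T, of "\<lambda>_. e" e "\<lambda>_. y"]) auto
  have "closed ?S" by (intro closed_Times) auto
  then have S: "l \<in> ?S" if "\<And>n. p n \<in> ?S" "p \<longlonglongrightarrow> l" for p l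
    using that closed_sequentially by blast
  have nzS: "snd p \<noteq> 0" if "p \<in> ?S" for p using that nz by auto
  have P: "closed ?P"
    unfolding closed_sequential_limits
  proof (intro allI impI, elim conjE)
    fix p l assume p: "\<forall>n. p n \<in> ?P" and l: "p \<longlonglongrightarrow> l"
    have "l \<in> ?S" using p by (intro S[OF _ l]) auto
    moreover have "\<not> derivation_type T (fst l) (snd l)"
      by (rule point_type_limit[OF X T tendsto_snd[OF l] _ _ tendsto_fst[OF l]])
        (use p \<open>l \<in> ?S\<close> nzS in blast)+
    ultimately show "l \<in> ?P" using point_or_derivation_type[OF X T] nzS by blast
  qed
  have D: "closed ?D"
    unfolding closed_sequential_limits
  proof (intro allI impI, elim conjE)
    fix p l assume p: "\<forall>n. p n \<in> ?D" and l: "p \<longlonglongrightarrow> l"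
    have "l \<in> ?S" using p by (intro S[OF _ l]) auto
    moreover have "derivation_type T (fst l) (snd l)"
      by (rule derivation_type_limit[OF T tendsto_snd[OF l] _ _ tendsto_fst[OF l]])
        (use p \<open>l \<in> ?S\<close> nzS in blast)+
    ultimately show "l \<in> ?D" by blast
  qed
  have cover: "?S \<subseteq> ?P \<union> ?D" using point_or_derivation_type[OF X T] nzS by blast
  have PD: "?P \<inter> ?D \<inter> ?S = {}" using disj nzS by blast
  have conn: "connected ?S" using Y by (intro connected_Times) auto
  have y1: "(y\<^sub>1, e\<^sub>1) \<in> ?P \<inter> ?S" and y2: "(y\<^sub>2, e\<^sub>2) \<in> ?D \<inter> ?S"
    using point deriv by auto
  from connected_closedD[OF conn PD cover P D] show False
    using y1 y2 by (elim disjE) (simp_all only: empty_iff)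
qed

text \<open>
  The image of a constant has a nonzero value at some point, and the functional supporting this
  value does not annihilate it, so that pair is of point type. Any other
  direction \<open>e\<close> is reached from the one of this pair along a segment avoiding zero, possibly
  after replacing \<open>e\<close> by \<open>-e\<close>, which does not affect the type.
\<close>

lemma point_type_everywhere:
  fixes T :: "('x::metric_space, 'e) lip \<Rightarrow> ('y::metric_space, 'e) lip"
  assumes X: "compact (UNIV :: 'x set)" and Y: "connected (UNIV :: 'y set)"
    and T: "T \<in> Iso (scale_lip s) (scale_lip s)" and e: "e \<noteq> 0"
  shows "point_type T y e"
proof -
  have "norm (T (const_lip e)) \<noteq> 0" using e by (simp add: Iso_norm[OF T] norm_const_lip)
  then obtain y\<^sub>0 where y0: "apply_lip (T (const_lip e)) y\<^sub>0 \<noteq> 0"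
    by (metis norm_zero lip_eqI zero_lip.rep_eq)
  let ?e\<^sub>0 = "apply_lip (T (const_lip e)) y\<^sub>0"
  have "\<not> derivation_type T y\<^sub>0 ?e\<^sub>0"
  proof
    assume "derivation_type T y\<^sub>0 ?e\<^sub>0"
    then have "support ?e\<^sub>0 ?e\<^sub>0 = 0" unfolding derivation_type_def by (rule spec)
    then show False using support_self[OF y0] y0 by simp
  qed
  then have point: "point_type T y\<^sub>0 ?e\<^sub>0" using point_or_derivation_type[OF X T y0] by blast
  have "\<not> derivation_type T y e"
  proof (cases "0 \<in> closed_segment ?e\<^sub>0 e")
    case True
    \<comment> \<open>Here \<open>e\<close> is a negative multiple of \<open>?e\<^sub>0\<close>, so \<open>-e\<close> is a positive one.\<close>
    have "0 \<notin> closed_segment ?e\<^sub>0 (- e)"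
    proof
      assume "0 \<in> closed_segment ?e\<^sub>0 (- e)"
      then obtain t where t: "0 \<le> t" "t \<le> 1" "(1 - t) *\<^sub>R ?e\<^sub>0 = t *\<^sub>R e"
        by (auto simp: in_segment)
      obtain u where u: "0 \<le> u" "u \<le> 1" "(1 - u) *\<^sub>R ?e\<^sub>0 = - (u *\<^sub>R e)"
        using True by (auto simp: in_segment add_eq_0_iff2)
      have "((1 - t) * u + (1 - u) * t) *\<^sub>R ?e\<^sub>0 = u *\<^sub>R ((1 - t) *\<^sub>R ?e\<^sub>0) + t *\<^sub>R ((1 - u) *\<^sub>R ?e\<^sub>0)"
        by (simp add: scaleR_left_distrib mult.commute)
      also have "\<dots> = 0" by (simp add: t u mult.commute)
      finally have "(1 - t) * u + (1 - u) * t = 0" using y0 by simp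
      then have "(1 - t) * u = 0" "(1 - u) * t = 0"
        using t u by (metis add_nonneg_eq_0_iff diff_ge_0_iff_ge mult_nonneg_nonneg)+
      then show False using t u y0 e by auto
    qed
    then have "\<not> derivation_type T y (- e)" by (rule point_type_along_segment[OF X Y T _ point])
    then show ?thesis using support_minus[OF e] by (simp add: derivation_type_def)
  next
    case False
    then show ?thesis by (rule point_type_along_segment[OF X Y T _ point])
  qed
  then show ?thesis using point_or_derivation_type[OF X T e] by blast
qed

section \<open>Isometries are weighted composition operators\<close>

text \<open>
  Suppose two vectors \<open>e\<^sub>0\<close> and \<open>e\<^sub>1\<close> led to different points. Disjoint bumps around these
  points then have images with nonzero values at \<open>y\<close>, although every functional \<open>support e\<close>
  looks at one point only and so annihilates one of these values: the norm would have a corner.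
\<close>

lemma isometry_base_point:
  fixes T :: "('x::metric_space, 'e) lip \<Rightarrow> ('y::metric_space, 'e) lip"
  assumes X: "compact (UNIV :: 'x set)" and Y: "connected (UNIV :: 'y set)"
    and T: "T \<in> Iso (scale_lip s) (scale_lip s)" and "\<exists>e :: 'e. e \<noteq> 0"
  shows "\<exists>x. \<forall>g. apply_lip g x = 0 \<longrightarrow> apply_lip (T g) y = 0"
proof -
  note point = point_type_everywhere[OF X Y T]
  obtain e\<^sub>0 :: 'e where e0: "e\<^sub>0 \<noteq> 0" using assms(4) by blast
  obtain x\<^sub>0 q\<^sub>0 where q0: "q\<^sub>0 \<in> dual_ball s"
    and eq0: "\<And>g. support e\<^sub>0 (apply_lip (T g) y) = q\<^sub>0 (apply_lip g x\<^sub>0)"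
    by (rule point_typeE[OF point[OF e0, of y]]) (rule that)
  have "apply_lip (T g) y = 0" if g: "apply_lip g x\<^sub>0 = 0" for g
  proof (rule ccontr)
    assume nz: "apply_lip (T g) y \<noteq> 0"
    define e\<^sub>1 where "e\<^sub>1 = apply_lip (T g) y"
    have e1: "e\<^sub>1 \<noteq> 0" using nz by (simp add: e\<^sub>1_def)
    obtain x\<^sub>1 q\<^sub>1 where q1: "q\<^sub>1 \<in> dual_ball s"
      and eq1: "\<And>g. support e\<^sub>1 (apply_lip (T g) y) = q\<^sub>1 (apply_lip g x\<^sub>1)"
      by (rule point_typeE[OF point[OF e1, of y]]) (rule that)
    have w: "q\<^sub>1 (apply_lip g x\<^sub>1) \<noteq> 0" 
      using eq1[of g, folded e\<^sub>1_def] support_self[OF e1] e1 by (metis norm_eq_zero of_real_eq_0_iff)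
    then have ne: "x\<^sub>0 \<noteq> x\<^sub>1" using g dual_ball_zero[OF q1] by auto
    define u where "u = apply_lip (inv T (const_lip e\<^sub>0)) x\<^sub>0"
    have "q\<^sub>0 u = of_real (norm e\<^sub>0)"
      using eq0[of "inv T (const_lip e\<^sub>0)"] support_self[OF e0]
      by (simp add: u_def Iso_inv_right[OF T])
    then have u: "q\<^sub>0 u \<noteq> 0" using e0 by simp
    define r where "r = dist x\<^sub>0 x\<^sub>1 / 2"
    have r: "0 < r" using ne by (simp add: r_def)
    let ?b\<^sub>0 = "bump_lip x\<^sub>0 r u" and ?b\<^sub>1 = "bump_lip x\<^sub>1 r (apply_lip g x\<^sub>1)"
    have disj: "apply_lip ?b\<^sub>0 z = 0 \<or> apply_lip ?b\<^sub>1 z = 0" for z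
      using dist_triangle2[of x\<^sub>0 x\<^sub>1 z] by (auto simp: r_def max_def dist_commute)
    show False
    proof (rule support_not_disjoint)
      show "apply_lip (T ?b\<^sub>0) y \<noteq> 0"
        using eq0[of ?b\<^sub>0] u r dual_ball_zero[OF support_ball[OF e0]]
        by (auto simp: dual_ball_scaleR[OF q0])
      show "apply_lip (T ?b\<^sub>1) y \<noteq> 0"
        using eq1[of ?b\<^sub>1] w r dual_ball_zero[OF support_ball[OF e1]]
        by (auto simp: dual_ball_scaleR[OF q1])
    next
      fix e :: 'e assume "e \<noteq> 0"
      obtain x q where q: "q \<in> dual_ball s"
        and eq: "\<And>g. support e (apply_lip (T g) y) = q (apply_lip g x)"
        by (rule point_typeE[OF point[OF \<open>e \<noteq> 0\<close>, of y]]) (rule that)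
      show "support e (apply_lip (T ?b\<^sub>0) y) = 0 \<or> support e (apply_lip (T ?b\<^sub>1) y) = 0"
        using disj[of x] dual_ball_zero[OF q] unfolding eq by metis
    qed
  qed
  then show ?thesis by blast
qed

lemma isometry_pointwise:
  fixes T :: "('x::metric_space, 'e) lip \<Rightarrow> ('y::metric_space, 'e) lip"
  assumes "compact (UNIV :: 'x set)" "connected (UNIV :: 'y set)"
    and T: "T \<in> Iso (scale_lip s) (scale_lip s)" and "\<exists>e :: 'e. e \<noteq> 0"
  obtains \<psi> where
    "\<And>f y. apply_lip (T f) y = apply_lip (T (const_lip (apply_lip f (\<psi> y)))) y"
proof -
  obtain \<psi> where \<psi>: "\<And>y g. apply_lip g (\<psi> y) = 0 \<Longrightarrow> apply_lip (T g) y = 0"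
    using isometry_base_point[OF assms] by metis
  have "apply_lip (T f) y = apply_lip (T (const_lip (apply_lip f (\<psi> y)))) y" for f y
    using \<psi>[of "f - const_lip (apply_lip f (\<psi> y))" y] by (simp add: Iso_diff[OF T])
  then show thesis by (rule that)
qed

text \<open>
  The pointwise description holds for \<open>T\<close> and for its inverse, with maps \<open>\<psi>\<close>, \<open>\<rho>\<close> and contractive
  weights \<open>V\<close>, \<open>W\<close>. Composing them, in either order, gives the identity, so \<open>\<psi>\<close> and \<open>\<rho>\<close> are inverse
  to each other and so are the weights; contractions inverse to each other are isometries.
\<close>

theorem isometry_weighted_composition:
  fixes T :: "('x::metric_space, 'e) lip \<Rightarrow> ('y::metric_space, 'e) lip"
  assumes X: "compact (UNIV :: 'x set)" "connected (UNIV :: 'x set)"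
    and Y: "compact (UNIV :: 'y set)" "connected (UNIV :: 'y set)"
    and T: "T \<in> Iso (scale_lip s) (scale_lip s)" and nontriv: "\<exists>e :: 'e. e \<noteq> 0"
  obtains \<psi> :: "'y \<Rightarrow> 'x" and V :: "'y \<Rightarrow> 'e \<Rightarrow> 'e"
  where "bij \<psi>" and "\<And>y. V y \<in> Iso s s"
    and "\<And>f y. apply_lip (T f) y = V y (apply_lip f (\<psi> y))"
proof -
  note U = Iso_inv[OF T] and TU = Iso_inv_right[OF T] and UT = Iso_inv_left[OF T]
  obtain e\<^sub>0 :: 'e where e0: "e\<^sub>0 \<noteq> 0" using nontriv by blast
  define V where "V y u = apply_lip (T (const_lip u)) y" for y u
  define W where "W x u = apply_lip (inv T (const_lip u)) x" for x u
  obtain \<psi> where "\<And>f y. apply_lip (T f) y = apply_lip (T (const_lip (apply_lip f (\<psi> y)))) y"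
    by (rule isometry_pointwise[OF X(1) Y(2) T nontriv]) (rule that)
  then have \<psi>: "apply_lip (T f) y = V y (apply_lip f (\<psi> y))" for f y
    unfolding V_def .
  obtain \<rho> where
    "\<And>g x. apply_lip (inv T g) x = apply_lip (inv T (const_lip (apply_lip g (\<rho> x)))) x"
    by (rule isometry_pointwise[OF Y(1) X(2) U nontriv]) (rule that)
  then have \<rho>: "apply_lip (inv T g) x = W x (apply_lip g (\<rho> x))" for g x
    unfolding W_def .
  have VW: "apply_lip g y = V y (W (\<psi> y) (apply_lip g (\<rho> (\<psi> y))))" for g y
    using \<psi>[of "inv T g" y] by (simp add: \<rho> TU)
  have WV: "apply_lip f x = W x (V (\<rho> x) (apply_lip f (\<psi> (\<rho> x))))" for f x
    using \<rho>[of "T f" x] by (simp add: \<psi> UT)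
  have zero: "V y 0 = 0" "W x 0 = 0" for x y
    using Iso_norm[OF T, of "const_lip 0"] Iso_norm[OF U, of "const_lip 0"]
    by (simp_all add: V_def W_def norm_const_lip)
  have \<rho>\<psi>: "\<rho> (\<psi> y) = y" for y
  proof (rule ccontr)
    assume *: "\<rho> (\<psi> y) \<noteq> y"
    then have "apply_lip (bump_lip y (dist (\<rho> (\<psi> y)) y) e\<^sub>0) y = 0"
      by (subst VW) (simp add: zero)
    then show False using * e0 by simp
  qed
  have \<psi>\<rho>: "\<psi> (\<rho> x) = x" for x
  proof (rule ccontr)
    assume *: "\<psi> (\<rho> x) \<noteq> x"
    then have "apply_lip (bump_lip x (dist (\<psi> (\<rho> x)) x) e\<^sub>0) x = 0"
      by (subst WV) (simp add: zero)
    then show False using * e0 by simp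
  qed
  have "bij \<psi>" by (rule o_bij[of \<rho>]) (auto simp: \<rho>\<psi> \<psi>\<rho>)
  moreover have "V y \<in> Iso s s" for y
  proof (rule IsoI)
    show "V y (u + v) = V y u + V y v" for u v
    proof -
      have "(const_lip (u + v) :: ('x, 'e) lip) = const_lip u + const_lip v" by (rule lip_eqI) simp
      then show ?thesis by (simp add: V_def Iso_add[OF T])
    qed
    show "V y (s c v) = s c (V y v)" for c v
    proof -
      have "(const_lip (s c v) :: ('x, 'e) lip) = scale_lip s c (const_lip v)"
        by (rule lip_eqI) (simp add: apply_scale_lip)
      then show ?thesis by (simp add: V_def Iso_scale[OF T] apply_scale_lip)
    qed
    have V_le: "norm (V y v) \<le> norm v" and W_le: "norm (W x v) \<le> norm v" for x v
      using apply_lip_le[of "T (const_lip v)" y] apply_lip_le[of "inv T (const_lip v)" x]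
      by (simp_all add: V_def W_def Iso_norm[OF T] Iso_norm[OF U] norm_const_lip)
    show "norm (V y v) = norm v" for v
      using V_le[of v] W_le[of "\<psi> y" "V y v"] WV[of "const_lip v" "\<psi> y"] by (simp add: \<rho>\<psi>)
    show "surj (V y)"
    proof (rule surjI)
      show "V y (W (\<psi> y) v) = v" for v using VW[of "const_lip v" y] by simp
    qed
  qed (rule normed_space_over_axioms)+
  ultimately show thesis using \<psi> that by blast
qed

end

section \<open>The truncated metric\<close>

text \<open>
  The classical fact that an isometric self-map of a compact space is onto, for the metric
  \<open>min d 1\<close>: the orbit of a point at positive distance from the range is uniformly discrete, and
  so has no convergent subsequence.
\<close>

lemma truncated_isometry_surj:
  fixes \<phi> :: "'x::metric_space \<Rightarrow> 'x"
  assumes X: "compact (UNIV :: 'x set)"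
    and \<phi>: "\<And>a b. min (dist (\<phi> a) (\<phi> b)) 1 = min (dist a b) 1"
  shows "surj \<phi>"
proof (rule ccontr)
  assume "\<not> surj \<phi>"
  then obtain x where x: "x \<notin> range \<phi>" by auto
  have "continuous_on UNIV \<phi>"
  proof (rule continuous_onI)
    fix a and e :: real assume "0 < e"
    have "dist (\<phi> b) (\<phi> a) \<le> e" if "dist b a < min e 1" for b
      using \<phi>[of b a] that by (auto simp: min_def split: if_splits)
    then show "\<exists>d>0. \<forall>b\<in>UNIV. dist b a < d \<longrightarrow> dist (\<phi> b) (\<phi> a) \<le> e"
      using \<open>0 < e\<close> by (intro exI[of _ "min e 1"]) auto
  qed
  then have "closed (range \<phi>)" using X by (intro compact_imp_closed compact_continuous_image)
  then obtain e where e: "0 < e" "\<And>a. e \<le> dist x (\<phi> a)"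
    using x unfolding closed_def open_dist by (force simp: not_less dist_commute)
  define orb where "orb n = (\<phi> ^^ n) x" for n
  have iter: "min (dist ((\<phi> ^^ n) a) ((\<phi> ^^ n) b)) 1 = min (dist a b) 1" for n a b
    by (induction n) (auto simp: \<phi>)
  have far: "min e 1 \<le> dist (orb n) (orb m)" if "n < m" for n m
  proof -
    obtain k where m: "m = n + Suc k" using \<open>n < m\<close> less_imp_Suc_add by auto
    have "min (dist (orb n) (orb m)) 1 = min (dist x (orb (Suc k))) 1"
      using iter[of n x "orb (Suc k)"] by (simp only: orb_def m funpow_add comp_apply)
    also have "\<dots> \<ge> min e 1" using e(2)[of "orb k"] by (auto simp: orb_def)
    finally show ?thesis by linarith
  qed
  obtain l r where r: "strict_mono (r :: nat \<Rightarrow> nat)" "(orb \<circ> r) \<longlonglongrightarrow> l"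
    using X unfolding compact_def by (metis UNIV_I)
  then have "Cauchy (orb \<circ> r)" by (simp add: LIMSEQ_imp_Cauchy)
  then obtain N where "\<And>m n. m \<ge> N \<Longrightarrow> n \<ge> N \<Longrightarrow> dist ((orb \<circ> r) m) ((orb \<circ> r) n) < min e 1"
    using e(1) unfolding Cauchy_def by (metis min_less_iff_conj zero_less_one)
  from this[of N "Suc N"] far[of "r N" "r (Suc N)"] r(1) show False
    by (auto simp: strict_mono_Suc_iff)
qed

lemma truncated_contraction_lipschitz:
  fixes \<phi> :: "'y::metric_space \<Rightarrow> 'x::metric_space"
  assumes X: "compact (UNIV :: 'x set)"
    and \<phi>: "\<And>a b. min (dist (\<phi> a) (\<phi> b)) 1 = min (dist a b) 1"
  shows "\<exists>C. C-lipschitz_on UNIV \<phi>"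
proof -
  obtain D where D: "\<And>a b :: 'x. dist a b \<le> D"
    using compact_imp_bounded[OF X] by (auto simp: bounded_two_points)
  have "(max D 1)-lipschitz_on UNIV \<phi>"
  proof (rule lipschitz_onI)
    fix a b
    show "dist (\<phi> a) (\<phi> b) \<le> max D 1 * dist a b"
    proof (cases "dist a b < 1")
      case True
      then have "dist (\<phi> a) (\<phi> b) \<le> 1 * dist a b"
        using \<phi>[of a b] by (auto simp: min_def split: if_splits)
      also have "\<dots> \<le> max D 1 * dist a b" by (intro mult_right_mono) auto
      finally show ?thesis .
    next
      case False
      have "dist (\<phi> a) (\<phi> b) \<le> max D 1 * 1" using D[of "\<phi> a" "\<phi> b"] by simp
      also have "\<dots> \<le> max D 1 * dist a b" using False by (intro mult_left_mono) auto
      finally show ?thesis .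
    qed
  qed simp
  then show ?thesis ..
qed

context normed_space_over
begin

text \<open>
  The function \<open>z \<mapsto> min (d(z, \<psi>(y'))) 1 \<cdot> e\<close> has norm at most \<open>\<parallel>e\<parallel>\<close>, and its image vanishes at \<open>y'\<close>.
  The Lipschitz bound for the image between \<open>y\<close> and \<open>y'\<close> is the assertion.
\<close>

lemma weighted_isometry_truncated_le:
  fixes T :: "('x::metric_space, 'e) lip \<Rightarrow> ('y::metric_space, 'e) lip"
  assumes T: "T \<in> Iso (scale_lip s) (scale_lip s)" and e: "(e :: 'e) \<noteq> 0"
    and norm: "\<And>f y. norm (apply_lip (T f) y) = norm (apply_lip f (\<psi> y))"
  shows "min (dist (\<psi> y) (\<psi> y')) 1 \<le> dist y y'"
proof -
  define h where "h = const_lip e - bump_lip (\<psi> y') 1 e"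
  have h: "apply_lip h z = (1 - max 0 (1 - dist z (\<psi> y'))) *\<^sub>R e" for z
    by (simp add: h_def scaleR_left_diff_distrib)
  have "norm h \<le> norm e"
    unfolding norm_lip_le_iff
  proof
    have "(0 + norm e)-lipschitz_on UNIV (\<lambda>z. e - max 0 (1 - dist z (\<psi> y')) *\<^sub>R e)"
      by (intro lipschitz_on_diff lipschitz_on_constant bump_lipschitz)
    then show "(norm e)-lipschitz_on UNIV (apply_lip h)" by (simp add: h_def)
    show "\<forall>z. norm (apply_lip h z) \<le> norm e"
      by (auto simp: h max_def mult_left_le_one_le)
  qed
  then have "norm (apply_lip (T h) y - apply_lip (T h) y') \<le> norm e * dist y y'"
    using apply_lip_diff_le[of "T h" y y'] mult_right_mono[of "norm h" "norm e" "dist y y'"]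
    by (simp add: Iso_norm[OF T])
  moreover have "apply_lip (T h) y' = 0"
    using norm[of h y'] by (simp add: h)
  moreover have "norm (apply_lip (T h) y) = min (dist (\<psi> y) (\<psi> y')) 1 * norm e"
    using norm[of h y] by (auto simp: h min_def max_def)
  ultimately show ?thesis using e by (simp add: mult.commute)
qed

lemma weighted_isometry_truncated_eq:
  fixes T :: "('x::metric_space, 'e) lip \<Rightarrow> ('y::metric_space, 'e) lip"
  assumes T: "T \<in> Iso (scale_lip s) (scale_lip s)" and e: "(e :: 'e) \<noteq> 0" and \<psi>: "bij \<psi>"
    and norm: "\<And>f y. norm (apply_lip (T f) y) = norm (apply_lip f (\<psi> y))"
  shows "min (dist (\<psi> y) (\<psi> y')) 1 = min (dist y y') 1"
proof -
  have inv: "\<psi> (inv \<psi> x) = x" "inv \<psi> (\<psi> y) = y" for x y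
    using \<psi> by (auto simp: bij_is_surj bij_is_inj surj_f_inv_f)
  have "norm (apply_lip (inv T g) x) = norm (apply_lip g (inv \<psi> x))" for g x
    using norm[of "inv T g" "inv \<psi> x"] by (simp add: Iso_inv_right[OF T] inv)
  from weighted_isometry_truncated_le[OF Iso_inv[OF T] e this, of "\<psi> y" "\<psi> y'"]
  have "min (dist y y') 1 \<le> dist (\<psi> y) (\<psi> y')" by (simp add: inv)
  moreover have "min (dist (\<psi> y) (\<psi> y')) 1 \<le> dist y y'"
    by (rule weighted_isometry_truncated_le[OF T e norm])
  ultimately show ?thesis by linarith
qed

end

section \<open>Two-local isometries\<close>

locale lip_two_local_isometry = smooth_space s
  for s :: "'k::real_or_complex \<Rightarrow> 'e::real_normed_vector \<Rightarrow> 'e" +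
  fixes \<Delta> :: "('x::metric_space, 'e) lip \<Rightarrow> ('y::metric_space, 'e) lip"
  assumes X: "compact (UNIV :: 'x set)" "connected (UNIV :: 'x set)"
    and Y: "compact (UNIV :: 'y set)" "connected (UNIV :: 'y set)"
    and nontriv: "\<exists>e :: 'e. e \<noteq> 0"
    and reflexive: "two_iso_reflexive s"
    and two_local: "two_local_isometry (scale_lip s) (scale_lip s) \<Delta>"
begin

text \<open>
  Two-locality in the form in which it is exploited: any two functions are moved by a common
  weighted composition operator, which depends on them. The truncated metric is included because
  its preservation is a bound that does not depend on the operator.
\<close>

lemma two_local_weighted_composition:
  obtains \<psi> :: "'y \<Rightarrow> 'x" and V :: "'y \<Rightarrow> 'e \<Rightarrow> 'e"
  where "bij \<psi>" and "\<And>y. V y \<in> Iso s s"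
    and "\<And>y y'. min (dist (\<psi> y) (\<psi> y')) 1 = min (dist y y') 1"
    and "\<And>y. apply_lip (\<Delta> f) y = V y (apply_lip f (\<psi> y))"
    and "\<And>y. apply_lip (\<Delta> g) y = V y (apply_lip g (\<psi> y))"
proof -
  obtain T where T: "T \<in> Iso (scale_lip s) (scale_lip s)" "\<Delta> f = T f" "\<Delta> g = T g"
    using two_local unfolding two_local_isometry_def by metis
  obtain \<psi> V where \<psi>: "bij \<psi>" and V: "\<And>y. V y \<in> Iso s s"
    and eq: "\<And>f y. apply_lip (T f) y = V y (apply_lip f (\<psi> y))"
    by (rule isometry_weighted_composition[OF X Y T(1) nontriv]) (rule that)
  obtain e :: 'e where e: "e \<noteq> 0" using nontriv by (rule exE)
  have "norm (apply_lip (T f) y) = norm (apply_lip f (\<psi> y))" for f y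
    by (simp add: eq Iso_norm[OF V])
  note trunc = weighted_isometry_truncated_eq[OF T(1) e \<psi> this]
  show thesis
    by (rule that[OF \<psi> V trunc]) (simp_all add: T eq)
qed

lemma norm_\<Delta>: "norm (\<Delta> f) = norm f"
  using two_local unfolding two_local_isometry_def by (metis Iso_norm)

definition direction :: 'e where "direction = (SOME e. e \<noteq> 0)"

lemma direction: "direction \<noteq> 0"
  using someI_ex[OF nontriv] by (simp add: direction_def)

text \<open>
  The point of \<open>Y\<close> at which the norm of the image of the peak at \<open>x\<close> is largest. It exists
  because a weighted composition operator with a bijective map carries the summit along.
\<close>

definition \<sigma> :: "'x \<Rightarrow> 'y"
  where "\<sigma> x = (SOME y. norm (apply_lip (\<Delta> (peak_lip x direction)) y) = 2 * norm direction)"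

lemma norm_at_\<sigma>: "norm (apply_lip (\<Delta> (peak_lip x direction)) (\<sigma> x)) = 2 * norm direction"
  unfolding \<sigma>_def
proof (rule someI_ex)
  obtain \<psi> V where \<psi>: "bij \<psi>" and V: "\<And>y. V y \<in> Iso s s"
    and eq: "\<And>y. apply_lip (\<Delta> (peak_lip x direction)) y = V y (apply_lip (peak_lip x direction) (\<psi> y))"
    by (rule two_local_weighted_composition[of "peak_lip x direction" "peak_lip x direction"]) (rule that)
  have "\<psi> (inv \<psi> x) = x" using \<psi> by (simp add: bij_is_surj surj_f_inv_f)
  then have "norm (apply_lip (\<Delta> (peak_lip x direction)) (inv \<psi> x)) = 2 * norm direction"
    by (simp add: eq Iso_norm[OF V] norm_apply_peak_lip_eq_iff[OF direction])
  then show "\<exists>y. norm (apply_lip (\<Delta> (peak_lip x direction)) y) = 2 * norm direction" ..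
qed

text \<open>
  Whatever second function is chosen, the operator that represents \<open>\<Delta>\<close> at it and at the peak
  at \<open>x\<close> sends \<open>\<sigma> x\<close> to \<open>x\<close>.
\<close>

lemma weighted_composition_at_\<sigma>:
  assumes V: "\<And>y. V y \<in> Iso s s"
    and eq: "\<And>y. apply_lip (\<Delta> (peak_lip x direction)) y = V y (apply_lip (peak_lip x direction) (\<psi> y))"
  shows "\<psi> (\<sigma> x) = x"
  using norm_at_\<sigma>[of x] by (simp add: eq Iso_norm[OF V] norm_apply_peak_lip_eq_iff[OF direction])

lemma norm_\<Delta>_at_\<sigma>: "norm (apply_lip (\<Delta> g) (\<sigma> x)) = norm (apply_lip g x)"
proof -
  obtain \<psi> V where "bij \<psi>" and V: "\<And>y. V y \<in> Iso s s"
    and peak: "\<And>y. apply_lip (\<Delta> (peak_lip x direction)) y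
      = V y (apply_lip (peak_lip x direction) (\<psi> y))"
    and g: "\<And>y. apply_lip (\<Delta> g) y = V y (apply_lip g (\<psi> y))"
    by (rule two_local_weighted_composition[of "peak_lip x direction" g]) (rule that)
  have "\<psi> (\<sigma> x) = x" by (rule weighted_composition_at_\<sigma>[OF V peak])
  then show ?thesis by (simp add: g Iso_norm[OF V])
qed

lemma \<sigma>_truncated: "min (dist (\<sigma> a) (\<sigma> b)) 1 = min (dist a b) 1"
proof -
  obtain \<psi> V where "bij \<psi>" and V: "\<And>y. V y \<in> Iso s s"
    and trunc: "\<And>y y'. min (dist (\<psi> y) (\<psi> y')) 1 = min (dist y y') 1"
    and a: "\<And>y. apply_lip (\<Delta> (peak_lip a direction)) y = V y (apply_lip (peak_lip a direction) (\<psi> y))"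
    and b: "\<And>y. apply_lip (\<Delta> (peak_lip b direction)) y = V y (apply_lip (peak_lip b direction) (\<psi> y))"
    by (rule two_local_weighted_composition[of "peak_lip a direction" "peak_lip b direction"]) (rule that)
  have "\<psi> (\<sigma> a) = a" "\<psi> (\<sigma> b) = b"
    by (rule weighted_composition_at_\<sigma>[OF V a] weighted_composition_at_\<sigma>[OF V b])+
  then show ?thesis using trunc[of "\<sigma> a" "\<sigma> b"] by simp
qed

lemma bij_\<sigma>: "bij \<sigma>"
proof (rule bijI)
  show "inj \<sigma>"
  proof (rule injI)
    fix a b assume "\<sigma> a = \<sigma> b"
    then show "a = b" using \<sigma>_truncated[of a b] by (auto simp: min_def split: if_splits)
  qed
  obtain \<psi> :: "'y \<Rightarrow> 'x" where \<psi>: "bij \<psi>"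
    and trunc: "\<And>y y'. min (dist (\<psi> y) (\<psi> y')) 1 = min (dist y y') 1"
    by (rule two_local_weighted_composition) (rule that)
  have "surj (\<lambda>x. \<psi> (\<sigma> x))"
    by (rule truncated_isometry_surj[OF X(1)]) (simp add: trunc \<sigma>_truncated)
  show "surj \<sigma>"
    unfolding surj_def
  proof
    fix y
    obtain x where "\<psi> y = \<psi> (\<sigma> x)" using \<open>surj (\<lambda>x. \<psi> (\<sigma> x))\<close> by (metis surjD)
    then show "\<exists>x. y = \<sigma> x" using \<psi> by (auto simp: bij_def inj_eq)
  qed
qed

definition W :: "'x \<Rightarrow> 'e \<Rightarrow> 'e"
  where "W x e = apply_lip (\<Delta> (const_lip e)) (\<sigma> x)"

text \<open>
  The operator common to \<open>g\<close> and to the constant function with value \<open>g(x)\<close> may send \<open>\<sigma> x\<close>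
  to a point other than \<open>x\<close>. The remedy is to compare both functions with the peak at \<open>x\<close> that has
  this value: the norm of its image at \<open>\<sigma> x\<close> is already known and forces the point to be \<open>x\<close>.
\<close>

lemma \<Delta>_at_\<sigma>: "apply_lip (\<Delta> g) (\<sigma> x) = W x (apply_lip g x)"
proof (cases "apply_lip g x = 0")
  case True
  then show ?thesis
    using norm_\<Delta>_at_\<sigma>[of g x] norm_\<Delta>_at_\<sigma>[of "const_lip 0" x] by (simp add: W_def)
next
  case False
  \<comment> \<open>The factor one half compensates the height 2 of the peak.\<close>
  define p where "p = peak_lip x ((1/2) *\<^sub>R apply_lip g x)"
  have p: "apply_lip p x = apply_lip g x" by (simp add: p_def apply_peak_lip)
  have "apply_lip (\<Delta> k) (\<sigma> x) = apply_lip (\<Delta> p) (\<sigma> x)" if k: "apply_lip k x = apply_lip g x" for k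
  proof -
    obtain \<psi> V where "bij \<psi>" and V: "\<And>y. V y \<in> Iso s s"
      and eq: "\<And>y. apply_lip (\<Delta> k) y = V y (apply_lip k (\<psi> y))"
        "\<And>y. apply_lip (\<Delta> p) y = V y (apply_lip p (\<psi> y))"
      by (rule two_local_weighted_composition[of k p]) (rule that)
    have "norm (apply_lip p (\<psi> (\<sigma> x))) = norm (apply_lip p x)"
      using norm_\<Delta>_at_\<sigma>[of p x] by (simp add: eq Iso_norm[OF V])
    then have "\<psi> (\<sigma> x) = x"
      using norm_apply_peak_lip_eq_iff[of "(1/2) *\<^sub>R apply_lip g x" x "\<psi> (\<sigma> x)"] False p
      by (simp add: p_def)
    then show ?thesis by (simp add: eq k p)
  qed
  from this[of g] this[of "const_lip (apply_lip g x)"] show ?thesis by (simp add: W_def)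
qed

lemma norm_W: "norm (W x e) = norm e"
  using norm_\<Delta>_at_\<sigma>[of "const_lip e" x] by (simp add: W_def)

lemma W_Iso: "W x \<in> Iso s s"
proof -
  have "two_local_isometry s s (W x)"
    unfolding two_local_isometry_def
  proof (intro allI)
    fix a b
    show "\<exists>T\<in>Iso s s. W x a = T a \<and> W x b = T b"
    proof (rule two_local_weighted_composition[of "const_lip a" "const_lip b"])
      fix \<psi> V
      assume "\<And>y. V y \<in> Iso s s"
        and "\<And>y. apply_lip (\<Delta> (const_lip a)) y = V y (apply_lip (const_lip a) (\<psi> y))"
        and "\<And>y. apply_lip (\<Delta> (const_lip b)) y = V y (apply_lip (const_lip b) (\<psi> y))"
      then show ?thesis by (intro bexI[of _ "V (\<sigma> x)"]) (simp_all add: W_def)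
    qed
  qed
  then show ?thesis
    using reflexive norm_W unfolding two_iso_reflexive_def Iso_def by blast
qed

text \<open>
  Images of constants are Lipschitz, so the weights vary in a Lipschitz way. This makes
  \<open>x \<mapsto> W\<^sub>x\<^sup>-\<^sup>1(g(\<sigma> x))\<close> a Lipschitz function, the preimage of \<open>g\<close>.
\<close>

lemma W_diff_le: "norm (W a u - W b u) \<le> norm u * dist (\<sigma> a) (\<sigma> b)"
  using apply_lip_diff_le[of "\<Delta> (const_lip u)" "\<sigma> a" "\<sigma> b"]
  by (simp add: W_def norm_\<Delta> norm_const_lip)

lemma lipschitz_\<sigma>: "\<exists>C. C-lipschitz_on UNIV \<sigma>"
  by (rule truncated_contraction_lipschitz[OF Y(1) \<sigma>_truncated])

lemma surj_\<Delta>: "surj \<Delta>"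
  unfolding surj_def
proof
  fix g
  define f where "f x = inv (W x) (apply_lip g (\<sigma> x))" for x
  have W_f: "W x (f x) = apply_lip g (\<sigma> x)" for x
    by (simp add: f_def Iso_inv_right[OF W_Iso])
  have norm_f: "norm (f x) \<le> norm g" for x
    using apply_lip_le[of g "\<sigma> x"] norm_W[of x "f x"] by (simp add: W_f)
  obtain C where C: "C-lipschitz_on UNIV \<sigma>" using lipschitz_\<sigma> ..
  have "(2 * norm g * C)-lipschitz_on UNIV f"
  proof (rule lipschitz_onI)
    fix a b
    have "norm (f a - f b) = norm (W b (f a) - W b (f b))"
      by (metis Iso_diff[OF W_Iso] norm_W)
    also have "\<dots> \<le> norm (W b (f a) - W a (f a)) + norm (W a (f a) - W b (f b))"
      using norm_triangle_ineq[of "W b (f a) - W a (f a)" "W a (f a) - W b (f b)"] by simp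
    also have "\<dots> \<le> norm (f a) * dist (\<sigma> b) (\<sigma> a) + norm g * dist (\<sigma> a) (\<sigma> b)"
      using W_diff_le[of b "f a" a] apply_lip_diff_le[of g "\<sigma> a" "\<sigma> b"] by (simp add: W_f)
    also have "\<dots> \<le> norm g * dist (\<sigma> a) (\<sigma> b) + norm g * dist (\<sigma> a) (\<sigma> b)"
      using norm_f[of a] by (simp add: dist_commute mult_right_mono)
    also have "\<dots> = 2 * norm g * dist (\<sigma> a) (\<sigma> b)" by simp
    also have "\<dots> \<le> 2 * norm g * (C * dist a b)"
      using lipschitz_onD[OF C, of a b] by (intro mult_left_mono) auto
    finally show "dist (f a) (f b) \<le> 2 * norm g * C * dist a b" by (simp add: dist_norm mult.assoc)
  qed (use lipschitz_on_nonneg[OF C] in simp)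
  moreover have "bounded (range f)" using norm_f by (auto simp: bounded_iff)
  ultimately have f: "apply_lip (Abs_lip f) = f" by (intro Abs_lip_inverse) auto
  have "\<Delta> (Abs_lip f) = g"
  proof (rule lip_eqI)
    fix y
    obtain x where "y = \<sigma> x" using bij_\<sigma> by (metis bij_pointE)
    then show "apply_lip (\<Delta> (Abs_lip f)) y = apply_lip g y" by (simp add: \<Delta>_at_\<sigma> f W_f)
  qed
  then show "\<exists>f. g = \<Delta> f" by metis
qed

lemma \<Delta>_Iso: "\<Delta> \<in> Iso (scale_lip s) (scale_lip s)"
proof (rule IsoI)
  show "\<Delta> (f + g) = \<Delta> f + \<Delta> g" for f g
  proof (rule lip_eqI)
    fix y
    obtain x where "y = \<sigma> x" using bij_\<sigma> by (metis bij_pointE)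
    then show "apply_lip (\<Delta> (f + g)) y = apply_lip (\<Delta> f + \<Delta> g) y"
      by (simp add: \<Delta>_at_\<sigma> Iso_add[OF W_Iso])
  qed
  show "\<Delta> (scale_lip s c f) = scale_lip s c (\<Delta> f)" for c f
  proof (rule lip_eqI)
    fix y
    obtain x where "y = \<sigma> x" using bij_\<sigma> by (metis bij_pointE)
    then show "apply_lip (\<Delta> (scale_lip s c f)) y = apply_lip (scale_lip s c (\<Delta> f)) y"
      by (simp add: \<Delta>_at_\<sigma> Iso_scale[OF W_Iso] apply_scale_lip)
  qed
qed (rule normed_space_over_lip norm_\<Delta> surj_\<Delta>)+

lemma lipschitz_homeomorphism_inv_\<sigma>: "lipschitz_homeomorphism (inv \<sigma>)"
proof -
  have "min (dist (inv \<sigma> a) (inv \<sigma> b)) 1 = min (dist a b) 1" for a b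
    using \<sigma>_truncated[of "inv \<sigma> a" "inv \<sigma> b"] bij_\<sigma> by (simp add: bij_is_surj surj_f_inv_f)
  then show ?thesis
    unfolding lipschitz_homeomorphism_def
    using bij_\<sigma> lipschitz_\<sigma> truncated_contraction_lipschitz[OF X(1), of "inv \<sigma>"]
    by (simp add: bij_imp_bij_inv inv_inv_eq)
qed

lemma weight_function:
  defines "V \<equiv> \<lambda>y. Blinfun (W (inv \<sigma> y))"
  shows "continuous_map euclidean
      (subtopology strong_operator_topology {T. blinfun_apply T \<in> Iso s s}) V"
    and "apply_lip (\<Delta> f) y = blinfun_apply (V y) (apply_lip f (inv \<sigma> y))"
proof -
  have \<sigma>_inv: "\<sigma> (inv \<sigma> y) = y" for y using bij_\<sigma> by (simp add: bij_is_surj surj_f_inv_f)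
  have "bounded_linear (W x)" for x
  proof (rule bounded_linear_intro[of _ 1])
    show "W x (u + v) = W x u + W x v" for u v by (rule Iso_add[OF W_Iso])
    show "W x (r *\<^sub>R u) = r *\<^sub>R W x u" for r u
      using Iso_scale[OF W_Iso, of x "of_real r" u] by (simp add: scale_of_real)
  qed (simp add: norm_W)
  then have V: "blinfun_apply (V y) = W (inv \<sigma> y)" for y
    by (simp add: V_def bounded_linear_Blinfun_apply)
  show "apply_lip (\<Delta> f) y = blinfun_apply (V y) (apply_lip f (inv \<sigma> y))"
    using \<Delta>_at_\<sigma>[of f "inv \<sigma> y"] by (simp add: V \<sigma>_inv)
  have "continuous_map euclidean euclidean (\<lambda>y. blinfun_apply (V y) e)" for e
    using continuous_apply_lip[of UNIV "\<Delta> (const_lip e)"] by (simp add: V W_def \<sigma>_inv)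
  then show "continuous_map euclidean
      (subtopology strong_operator_topology {T. blinfun_apply T \<in> Iso s s}) V"
    by (auto simp: continuous_map_in_subtopology continuous_on_strong_operator_topo_iff_coordinatewise
        V W_Iso)
qed

end

theorem theorem2p6:
  fixes s :: "'k::real_or_complex \<Rightarrow> 'e::banach \<Rightarrow> 'e"
    and \<Delta> :: "('x::metric_space, 'e) lip \<Rightarrow> ('y::metric_space, 'e) lip"
  assumes "compact (UNIV :: 'x set)" and "path_connected (UNIV :: 'x set)"
    and "compact (UNIV :: 'y set)" and "path_connected (UNIV :: 'y set)"
    and "normed_space_over s" and "\<exists>e :: 'e. e \<noteq> 0"
    and "smooth s" and "reflexive_space s" and "two_iso_reflexive s"
    and "two_local_isometry (scale_lip s) (scale_lip s) \<Delta>"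
  shows "(\<exists>(\<psi> :: 'y \<Rightarrow> 'x) (V :: 'y \<Rightarrow> ('e \<Rightarrow>\<^sub>L 'e)).
            lipschitz_homeomorphism \<psi> \<and>
            continuous_map euclidean
              (subtopology strong_operator_topology {T. blinfun_apply T \<in> Iso s s}) V \<and>
            (\<forall>y f. apply_lip (\<Delta> f) y = blinfun_apply (V y) (apply_lip f (\<psi> y))))
         \<and> \<Delta> \<in> Iso (scale_lip s) (scale_lip s)"
proof -
  interpret lip_two_local_isometry s \<Delta>
    using assms path_connected_imp_connected[OF assms(2)] path_connected_imp_connected[OF assms(4)]
    by (intro lip_two_local_isometry.intro smooth_space.intro smooth_space_axioms.intro
        lip_two_local_isometry_axioms.intro)
  show ?thesis
    using lipschitz_homeomorphism_inv_\<sigma> weight_function \<Delta>_Iso by blast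
qed

end
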